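(* Let $n\geq2$ be such that all the eigenvalues in both $S_n$ and $\widetilde S_n$ are simple, and let $K\geq1$ be an integer. With the notation of the context, let $w\in S_K^{(n)}$ and its coefficients $w_{kl}$ be related by $$w=\sum_{l=1}^{n-1}w_{0l}s_0^{(l)}+\sum_{k=1}^{K-1}\sum_{l=1}^nw_{kl}s_k^{(l)}.$$ 1. (Inverse $F_n$-transform: computing $w$ from $\{w_{kl}\}$.) The following formulas hold: $$w_j=\sum_{k=1}^{K-1}\Big(\sum_{l=1}^nw_{kl}\Big)\sin\frac{\pi kj}{K},\quad j=1,\dots,K-1,$$ $$w_{j-1/2}=(-P)^{j-1}\sum_{l=1}^{n-1}w_{0l}e^{(l)}+2\sum_{k=1}^{K-1}d_{k,e}\cos\frac{\pi k}{2K}\sin\frac{\pi k(j-1/2)}{K}-2\sum_{k=1}^{K-1}d_{k,o}\sin\frac{\pi k}{2K}\cos\frac{\pi k(j-1/2)}{K},\quad j=1,\dots,K,$$ where $d_{k,e}$ and $d_{k,o}$ are respectively the even and odd components of the vectors $d_k:=\sum_{l=1}^nw_{kl}p_k^{(l)}$. (Note that $(-P)^{j-1}e=e$ for odd $j$ and $(-P)^{j-1}e=-\check e$ for even $j$, for any $e\in\mathbb{R}^{n-1}$.) The collection $\{w_j\}_{j=1}^{K-1}$ can be computed by the standard inverse FFT with respect to sines (DST-I). The collection $\{w_{j-1/2}\}_{j=1}^K$ can be computed by $n-1$ modified inverse FFTs related to the centers of elements, $[n/2]$ of them with respect to sines (DST-III) and $[(n-1)/2]$ with respect to cosines (DCT-III),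 using the extensions $d_{K,e}:=0$ and $d_{0,o}:=0$. 2. (Direct $F_n$-transform: computing $\{w_{kl}\}$ from $w$.) The following formula holds: $$w_{kl}=\frac{(\mathcal{C}w,s_k^{(l)})_{S_K^{(n)}}}{\|s_k^{(l)}\|_{\mathcal{C}}^2}.$$ Here, first, for $k=0$ and $l=1,\dots,n-1$, $$(\mathcal{C}w,s_0^{(l)})_{S_K^{(n)}}=\Big(\widetilde C\sum_{j=1}^K(-P)^{j-1}w_{j-1/2}\Big)\cdot e^{(l)},\qquad\|s_0^{(l)}\|_{\mathcal{C}}^2=K.$$ Second, for $k=1,\dots,K-1$, $l=1,\dots,n$ and $y:=\mathcal{C}w$, $$(y,s_k^{(l)})_{S_K^{(n)}}=\sum_{j=1}^{K-1}y_j\sin\frac{\pi kj}{K}+p_{k,e}^{(l)}\cdot\sum_{j=1}^{K-1}(y_{j-1/2}+y_{j+1/2})_e\sin\frac{\pi kj}{K}+p_{k,o}^{(l)}\cdot\sum_{j=1}^{K-1}(y_{j+1/2}-y_{j-1/2})_o\sin\frac{\pi kj}{K},$$ $$\|s_k^{(l)}\|_{\mathcal{C}}^2=K(b_{kl,0}+b_{kl,n}\theta_k),\quad b_{kl,0}=c_0+(\widetilde Cp_k^{(l)}+2c)\cdot p_k^{(l)},\quad b_{kl,n}=c_n+(\widetilde Cp_k^{(l)}+2c)\cdot\check p_k^{(l)}.$$ The collection of all these coefficients can be computed using $n$ standard direct FFTs with respect to sines (DST-I).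
   Context: Local matrices. Let $\mathcal{P}_n$ be the space of real polynomials of degree at most $n$ and $\{e_l\}_{l=0}^n$ its Lagrange basis with $e_l(-1+2k/n)=\delta_{kl}$, $k,l=0,\dots,n$. Let $A=\{A_{kl}\}_{k,l=0}^n$, $C=\{C_{kl}\}_{k,l=0}^n$ with $A_{kl}=\int_{-1}^1 e_k'e_l'\,dx$, $C_{kl}=\int_{-1}^1e_ke_l\,dx$. For $p\in\mathbb{R}^{n-1}$ set $\check p_l=(Pp)_l=p_{n-l}$, $l=1,\dots,n-1$; $p$ is even if $Pp=p$ and odd if $Pp=-p$; the even and odd components of $p$ are $p_e=(p+\check p)/2$ and $p_o=(p-\check p)/2$ (with $p_{k,e}^{(l)},p_{k,o}^{(l)}$ denoting those of $p_k^{(l)}$). The matrices have the block form $$A=\begin{pmatrix} a_0 & a^T & a_n \\ a & \widetilde A & \check a \\ a_n & \check a^T & a_0 \end{pmatrix},\qquad C=\begin{pmatrix} c_0 & c^T & c_n \\ c & \widetilde C & \check c \\ c_n & \check c^T & c_0 \end{pmatrix},$$ where $\widetilde A,\widetilde C$ are of order $n-1$ and $a,c\in\mathbb{R}^{n-1}$. Set $\widetilde G(\lambda)=\widetilde A-\lambda\widetilde C$, $g(\lambda)=a-\lambda c$. The symbol $\cdot$ denotes the inner product in $\mathbb{R}^{n-1}$, and $[\,\cdot\,]$ in $[n/2]$ the integer part. Local spectra. $S_n$ is the spectrum of $Ae=\lambda Ce$, $e\in\mathbb{R}^{n+1}$, $e\neq0$, and $\widetilde S_n$ is the spectrum of $\widetilde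 Ae=\lambda\widetilde Ce$, $e\in\mathbb{R}^{n-1}$, $e\neq0$. Let $\{\lambda_0^{(l)},e^{(l)}\}_{l=1}^{n-1}$ be the eigenpairs of the second problem; each $e^{(l)}$ is even or odd, and they are scaled so that $\widetilde Ce^{(l)}\cdot e^{(l)}=1$. Set $a^{(l)}=a\cdot e^{(l)}$, $c^{(l)}=c\cdot e^{(l)}$, $\check a^{(l)}=\check a\cdot e^{(l)}$, $\check c^{(l)}=\check c\cdot e^{(l)}$. Global objects. $S_K^{(n)}$ is the space of vector functions $w$ consisting of $w_j\in\mathbb{R}$, $j=0,\dots,K$, with $w_0=w_K=0$, and $w_{j-1/2}\in\mathbb{R}^{n-1}$, $j=1,\dots,K$. Its inner product is $(y,v)_{S_K^{(n)}}=\sum_{j=1}^{K-1}y_jv_j+\sum_{j=1}^Ky_{j-1/2}\cdot v_{j-1/2}$. The global (scaled) mass operator $\mathcal{C}$ in $S_K^{(n)}$ is given by $$(\mathcal{C}w)_j=c_nw_{j-1}+\check c\cdot w_{j-1/2}+2c_0w_j+c\cdot w_{j+1/2}+c_nw_{j+1},\ j=1,\dots,K-1,$$ $$(\mathcal{C}w)_{j-1/2}=c\,w_{j-1}+\widetilde Cw_{j-1/2}+\check c\,w_j,\ j=1,\dots,K,$$ with $(\mathcal{C}w)_0=(\mathcal{C}w)_K=0$, and $\|v\|_{\mathcal{C}}^2=(\mathcal{C}v,v)_{S_K^{(n)}}$. The global stiffness operator $\mathcal{A}$ is given by the same formulas with $a_0,a_n,a,\check a,\widetilde A$ in place of $c_0,c_n,c,\check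 c,\widetilde C$. Eigenvectors (of the problem $\mathcal{A}v=\lambda\mathcal{C}v$ in $S_K^{(n)}$). Let $\theta_k=\cos\frac{\pi k}{K}$. For $k=1,\dots,K-1$, let $\lambda_k^{(1)},\dots,\lambda_k^{(n)}$ be the $n$ distinct solutions (all positive real and not in $\widetilde S_n$) of $$a_0-\lambda c_0+\sum_{l=1}^{n-1}\frac{(a^{(l)}-\lambda c^{(l)})^2}{\lambda-\lambda_0^{(l)}}=-\theta_k\Big(a_n-\lambda c_n+\sum_{l=1}^{n-1}\frac{(\check a^{(l)}-\lambda\check c^{(l)})(a^{(l)}-\lambda c^{(l)})}{\lambda-\lambda_0^{(l)}}\Big),$$ and let $p_k^{(l)}\in\mathbb{R}^{n-1}$ be the solution of $\widetilde G(\lambda_k^{(l)})p_k^{(l)}=-g(\lambda_k^{(l)})$. Define $s_k^{(l)}\in S_K^{(n)}$ by $$s_{0,j}^{(l)}=0,\qquad s_{0,j-1/2}^{(l)}=(-P)^{j-1}e^{(l)}\qquad(l=1,\dots,n-1),$$ $$s_{k,j}^{(l)}=\sin\frac{\pi kj}{K},\qquad s_{k,j-1/2}^{(l)}=p_k^{(l)}\sin\frac{\pi k(j-1)}{K}+\check p_k^{(l)}\sin\frac{\pi kj}{K}\qquad(k=1,\dots,K-1,\ l=1,\dots,n),$$ where nodal values are for $j=1,\dots,K-1$ and element values for $j=1,\dots,K$. These vectors form a $\mathcal{C}$-orthogonal basis of $S_K^{(n)}$, so the coefficients $w_{kl}$ of any $w\in S_K^{(n)}$ are uniquely defined. Transforms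 (up to normalization): DST-I is $x\mapsto\sum_{k=1}^{K-1}x_k\sin\frac{\pi kj}{K}$, $j=1,\dots,K-1$ (and, as direct transform, with the roles of $k$ and $j$ exchanged); DST-III is $x\mapsto\sum_{k=1}^{K}x_k\sin\frac{\pi k(j-1/2)}{K}$, $j=1,\dots,K$; DCT-III is $x\mapsto\sum_{k=0}^{K-1}x_k\cos\frac{\pi k(j-1/2)}{K}$, $j=1,\dots,K$. Each is computed by a fast Fourier transform (FFT) algorithm. *)

theory Defs
  imports "HOL-Analysis.Analysis" "HOL-Computational_Algebra.Polynomial"
begin

text \<open>
  A real vector with \<open>n - 1\<close> components is a function \<open>nat \<Rightarrow> real\<close> of which only the
  components with index in \<open>{1..n-1}\<close> are relevant; a matrix of order \<open>n + 1\<close> is a function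
  \<open>nat \<Rightarrow> nat \<Rightarrow> real\<close> with relevant indices \<open>{0..n}\<close>.
\<close>

definition node :: "nat \<Rightarrow> nat \<Rightarrow> real" where
  "node n k = - 1 + 2 * real k / real n"

definition is_lagrange :: "nat \<Rightarrow> nat \<Rightarrow> real poly \<Rightarrow> bool" where
  "is_lagrange n l p \<longleftrightarrow>
     degree p \<le> n \<and> (\<forall>k\<in>{0..n}. poly p (node n k) = (if k = l then 1 else 0))"

lemma ex1_lagrange:
  assumes "n \<ge> 1" "l \<le> n"
  shows "\<exists>!p. is_lagrange n l p"
proof -
  have inj: "inj_on (node n) {0..n}"
    using assms(1) by (simp add: inj_on_def node_def)
  define q where "q = (\<Prod>k\<in>{0..n} - {l}. [:- node n k, 1:])"
  have q: "poly q x = (\<Prod>k\<in>{0..n} - {l}. x - node n k)" for x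
    by (simp add: q_def poly_prod)
  have ql: "poly q (node n l) \<noteq> 0"
    unfolding q using inj_onD[OF inj, of l] assms(2) by (simp add: prod_zero_iff) fastforce
  have qk: "poly q (node n k) = 0" if "k \<in> {0..n}" "k \<noteq> l" for k
    unfolding q using that by (intro prod_zero) auto
  have dq: "degree q = n"
    unfolding q_def using assms(2) by (subst degree_prod_eq_sum_degree) simp_all
  have ex: "is_lagrange n l (smult (inverse (poly q (node n l))) q)"
    unfolding is_lagrange_def
  proof (intro conjI ballI)
    show "degree (smult (inverse (poly q (node n l))) q) \<le> n"
      using degree_smult_le[of _ q] dq by simp
    show "poly (smult (inverse (poly q (node n l))) q) (node n k) = (if k = l then 1 else 0)"
      if "k \<in> {0..n}" for k
      using ql qk[OF that] by (cases "k = l") simp_all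
  qed
  have card: "card (node n ` {0..n}) = Suc n"
    using inj by (simp add: card_image)
  have "p = r" if p: "is_lagrange n l p" and r: "is_lagrange n l r" for p r
  proof (rule poly_eqI_degree[of "node n ` {0..n}"])
    show "poly p x = poly r x" if "x \<in> node n ` {0..n}" for x
      using that p r unfolding is_lagrange_def by fastforce
    show "degree p < card (node n ` {0..n})" "degree r < card (node n ` {0..n})"
      using p r unfolding is_lagrange_def card by simp_all
  qed
  with ex show ?thesis by blast
qed

definition lagrange :: "nat \<Rightarrow> nat \<Rightarrow> real poly" where
  "lagrange n l = (THE p. is_lagrange n l p)"

definition stiff :: "nat \<Rightarrow> nat \<Rightarrow> nat \<Rightarrow> real" where
  "stiff n k l = integral {-1..1}
     (\<lambda>x. poly (pderiv (lagrange n k)) x * poly (pderiv (lagrange n l)) x)"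

definition mass :: "nat \<Rightarrow> nat \<Rightarrow> nat \<Rightarrow> real" where
  "mass n k l = integral {-1..1} (\<lambda>x. poly (lagrange n k) x * poly (lagrange n l) x)"

text \<open>
  Blocks of a matrix \<open>M\<close> of order \<open>n + 1\<close>: the corner entries are \<open>M 0 0\<close> and \<open>M 0 n\<close>, the
  vector next to the corner is \<open>bvec M\<close>, and the inner block of order \<open>n - 1\<close> is \<open>M\<close> itself
  with indices restricted to \<open>{1..n-1}\<close>.
\<close>

definition bvec :: "(nat \<Rightarrow> nat \<Rightarrow> real) \<Rightarrow> nat \<Rightarrow> real" where
  "bvec M i = M i 0"

definition dot :: "nat \<Rightarrow> (nat \<Rightarrow> real) \<Rightarrow> (nat \<Rightarrow> real) \<Rightarrow> real" where
  "dot n u v = (\<Sum>i=1..n-1. u i * v i)"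

definition inner_mult :: "nat \<Rightarrow> (nat \<Rightarrow> nat \<Rightarrow> real) \<Rightarrow> (nat \<Rightarrow> real) \<Rightarrow> nat \<Rightarrow> real" where
  "inner_mult n M v i = (\<Sum>m=1..n-1. M i m * v m)"

definition mirror :: "nat \<Rightarrow> (nat \<Rightarrow> real) \<Rightarrow> nat \<Rightarrow> real" where
  "mirror n p l = p (n - l)"

definition neg_mirror :: "nat \<Rightarrow> (nat \<Rightarrow> real) \<Rightarrow> nat \<Rightarrow> real" where
  "neg_mirror n p l = - mirror n p l"

definition even_part :: "nat \<Rightarrow> (nat \<Rightarrow> real) \<Rightarrow> nat \<Rightarrow> real" where
  "even_part n p i = (p i + mirror n p i) / 2"

definition odd_part :: "nat \<Rightarrow> (nat \<Rightarrow> real) \<Rightarrow> nat \<Rightarrow> real" where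
  "odd_part n p i = (p i - mirror n p i) / 2"

text \<open>The generalized eigenvalue problem \<open>M v = \<mu> N v\<close> on the index set \<open>I\<close>.\<close>

definition gen_eigenvector ::
  "nat set \<Rightarrow> (nat \<Rightarrow> nat \<Rightarrow> real) \<Rightarrow> (nat \<Rightarrow> nat \<Rightarrow> real) \<Rightarrow> real \<Rightarrow> (nat \<Rightarrow> real) \<Rightarrow> bool" where
  "gen_eigenvector I M N \<mu> v \<longleftrightarrow>
     (\<exists>i\<in>I. v i \<noteq> 0) \<and> (\<forall>i\<in>I. (\<Sum>j\<in>I. M i j * v j) = \<mu> * (\<Sum>j\<in>I. N i j * v j))"

definition gen_spectrum ::
  "nat set \<Rightarrow> (nat \<Rightarrow> nat \<Rightarrow> real) \<Rightarrow> (nat \<Rightarrow> nat \<Rightarrow> real) \<Rightarrow> real set" where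
  "gen_spectrum I M N = {\<mu>. \<exists>v. gen_eigenvector I M N \<mu> v}"

text \<open>
  Simplicity is one-dimensionality of the eigenspace; for the symmetric-definite pencils used
  here the geometric and the algebraic multiplicity coincide.
\<close>

definition simple_eigenvalue ::
  "nat set \<Rightarrow> (nat \<Rightarrow> nat \<Rightarrow> real) \<Rightarrow> (nat \<Rightarrow> nat \<Rightarrow> real) \<Rightarrow> real \<Rightarrow> bool" where
  "simple_eigenvalue I M N \<mu> \<longleftrightarrow> \<mu> \<in> gen_spectrum I M N \<and>
     (\<forall>u v. gen_eigenvector I M N \<mu> u \<and> gen_eigenvector I M N \<mu> v
        \<longrightarrow> (\<exists>c. \<forall>i\<in>I. u i = c * v i))"

definition spec_full :: "nat \<Rightarrow> real set" where
  "spec_full n = gen_spectrum {0..n} (stiff n) (mass n)"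

definition spec_inner :: "nat \<Rightarrow> real set" where
  "spec_inner n = gen_spectrum {1..n-1} (stiff n) (mass n)"

text \<open>
  The equation for the eigenvalues, with \<open>\<theta>\<close> in place of \<open>\<theta>\<^sub>k\<close>, \<open>\<lambda>\<^sub>0\<close> and \<open>e\<close> the
  eigenpairs of the inner problem. Since \<open>x / 0 = 0\<close> in HOL, the values of \<open>\<mu>\<close> at which the
  equation is meaningless (the poles, i.e. the points of \<open>spec_inner n\<close>) are excluded explicitly.
\<close>

definition spectral_solutions ::
  "nat \<Rightarrow> (nat \<Rightarrow> real) \<Rightarrow> (nat \<Rightarrow> nat \<Rightarrow> real) \<Rightarrow> real \<Rightarrow> real set" where
  "spectral_solutions n lam0 e \<theta> = {\<mu>. \<mu> \<notin> spec_inner n \<and>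
     stiff n 0 0 - \<mu> * mass n 0 0
       + (\<Sum>l=1..n-1. (dot n (bvec (stiff n)) (e l) - \<mu> * dot n (bvec (mass n)) (e l))\<^sup>2
                        / (\<mu> - lam0 l))
     = - \<theta> * (stiff n 0 n - \<mu> * mass n 0 n
       + (\<Sum>l=1..n-1. (dot n (mirror n (bvec (stiff n))) (e l)
                          - \<mu> * dot n (mirror n (bvec (mass n))) (e l))
                        * (dot n (bvec (stiff n)) (e l) - \<mu> * dot n (bvec (mass n)) (e l))
                        / (\<mu> - lam0 l)))}"

text \<open>
  Global vector functions: \<open>nodal w j\<close> is \<open>w\<^sub>j\<close> (\<open>0 \<le> j \<le> K\<close>) and \<open>elt w j\<close> is the vector
  with half-integer index \<open>j - 1/2\<close> (\<open>1 \<le> j \<le> K\<close>). Other indices carry no information.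
\<close>

record gfun =
  nodal :: "nat \<Rightarrow> real"
  elt :: "nat \<Rightarrow> nat \<Rightarrow> real"

definition SK :: "nat \<Rightarrow> gfun set" where
  "SK K = {w. nodal w 0 = 0 \<and> nodal w K = 0}"

definition SK_eq :: "nat \<Rightarrow> nat \<Rightarrow> gfun \<Rightarrow> gfun \<Rightarrow> bool" where
  "SK_eq n K v w \<longleftrightarrow> (\<forall>j\<in>{0..K}. nodal v j = nodal w j) \<and>
     (\<forall>j\<in>{1..K}. \<forall>i\<in>{1..n-1}. elt v j i = elt w j i)"

definition SK_inner :: "nat \<Rightarrow> nat \<Rightarrow> gfun \<Rightarrow> gfun \<Rightarrow> real" where
  "SK_inner n K y v =
     (\<Sum>j=1..K-1. nodal y j * nodal v j) + (\<Sum>j=1..K. dot n (elt y j) (elt v j))"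

definition glob_op :: "nat \<Rightarrow> nat \<Rightarrow> (nat \<Rightarrow> nat \<Rightarrow> real) \<Rightarrow> gfun \<Rightarrow> gfun" where
  "glob_op n K M w = \<lparr>
     nodal = (\<lambda>j. if j \<in> {1..K-1}
       then M 0 n * nodal w (j - 1) + dot n (mirror n (bvec M)) (elt w j) + 2 * M 0 0 * nodal w j
            + dot n (bvec M) (elt w (j + 1)) + M 0 n * nodal w (j + 1)
       else 0),
     elt = (\<lambda>j i. bvec M i * nodal w (j - 1) + inner_mult n M (elt w j) i
            + mirror n (bvec M) i * nodal w j) \<rparr>"

definition glob_mass :: "nat \<Rightarrow> nat \<Rightarrow> gfun \<Rightarrow> gfun" where
  "glob_mass n K = glob_op n K (mass n)"

definition mass_norm_sq :: "nat \<Rightarrow> nat \<Rightarrow> gfun \<Rightarrow> real" where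
  "mass_norm_sq n K v = SK_inner n K (glob_mass n K v) v"

definition sn :: "nat \<Rightarrow> nat \<Rightarrow> nat \<Rightarrow> real" where
  "sn K k j = sin (pi * real k * real j / real K)"

definition theta :: "nat \<Rightarrow> nat \<Rightarrow> real" where
  "theta K k = cos (pi * real k / real K)"

text \<open>\<open>s_zero\<close> is built from an eigenvector \<open>e\<close> of the inner problem, \<open>s_pos\<close> from \<open>p\<close> for given \<open>k\<close>.\<close>

definition s_zero :: "nat \<Rightarrow> (nat \<Rightarrow> real) \<Rightarrow> gfun" where
  "s_zero n e = \<lparr> nodal = (\<lambda>j. 0), elt = (\<lambda>j. (neg_mirror n ^^ (j - 1)) e) \<rparr>"

definition s_pos :: "nat \<Rightarrow> nat \<Rightarrow> nat \<Rightarrow> (nat \<Rightarrow> real) \<Rightarrow> gfun" where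
  "s_pos n K k p = \<lparr> nodal = (\<lambda>j. if j \<in> {1..K-1} then sn K k j else 0),
     elt = (\<lambda>j i. p i * sn K k (j - 1) + mirror n p i * sn K k j) \<rparr>"

definition expansion ::
  "nat \<Rightarrow> nat \<Rightarrow> (nat \<Rightarrow> nat \<Rightarrow> real) \<Rightarrow> (nat \<Rightarrow> nat \<Rightarrow> gfun) \<Rightarrow> gfun" where
  "expansion n K wc s = \<lparr>
     nodal = (\<lambda>j. (\<Sum>l=1..n-1. wc 0 l * nodal (s 0 l) j)
                + (\<Sum>k=1..K-1. \<Sum>l=1..n. wc k l * nodal (s k l) j)),
     elt = (\<lambda>j i. (\<Sum>l=1..n-1. wc 0 l * elt (s 0 l) j i)
                + (\<Sum>k=1..K-1. \<Sum>l=1..n. wc k l * elt (s k l) j i)) \<rparr>"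

definition DST_I :: "nat \<Rightarrow> (nat \<Rightarrow> real) \<Rightarrow> nat \<Rightarrow> real" where
  "DST_I K x j = (\<Sum>k=1..K-1. x k * sin (pi * real k * real j / real K))"

definition DST_III :: "nat \<Rightarrow> (nat \<Rightarrow> real) \<Rightarrow> nat \<Rightarrow> real" where
  "DST_III K x j = (\<Sum>k=1..K. x k * sin (pi * real k * (real j - 1/2) / real K))"

definition DCT_III :: "nat \<Rightarrow> (nat \<Rightarrow> real) \<Rightarrow> nat \<Rightarrow> real" where
  "DCT_III K x j = (\<Sum>k=0..K-1. x k * cos (pi * real k * (real j - 1/2) / real K))"

text \<open>
  Data flow of the fast transforms. An even vector is determined by its components
  \<open>1, \<dots>, n div 2\<close> and an odd one by its components \<open>1, \<dots>, (n - 1) div 2\<close> (for even \<open>n\<close> the middle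
  component of an odd vector vanishes), so that each retained component costs one scalar transform.

  Inverse transform: \<open>i\<close> numbers the scalar transforms, \<open>k\<close> is the position in the input array,
  and \<open>d k\<close> stands for \<open>d\<^sub>k\<close>, \<open>1 \<le> k \<le> K - 1\<close>, extended by zero to \<open>k = K\<close> (even part) and to
  \<open>k = 0\<close> (odd part).
\<close>

definition inv_input_even :: "nat \<Rightarrow> nat \<Rightarrow> (nat \<Rightarrow> nat \<Rightarrow> real) \<Rightarrow> nat \<Rightarrow> nat \<Rightarrow> real" where
  "inv_input_even n K d i k =
     2 * (if k = K then 0 else even_part n (d k) i) * cos (pi * real k / (2 * real K))"

definition inv_input_odd :: "nat \<Rightarrow> nat \<Rightarrow> (nat \<Rightarrow> nat \<Rightarrow> real) \<Rightarrow> nat \<Rightarrow> nat \<Rightarrow> real" where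
  "inv_input_odd n K d i k =
     - 2 * (if k = 0 then 0 else odd_part n (d k) i) * sin (pi * real k / (2 * real K))"

text \<open>
  Direct transform: the input arrays of the \<open>n\<close> scalar transforms, numbered by \<open>m < n\<close>: one for
  the nodal values, \<open>n div 2\<close> for the even and \<open>(n - 1) div 2\<close> for the odd components. The weights
  recover an inner product of two even (or two odd) vectors from the retained components: each of
  them counts twice, except for the middle one.
\<close>

definition dir_input :: "nat \<Rightarrow> gfun \<Rightarrow> nat \<Rightarrow> nat \<Rightarrow> real" where
  "dir_input n y m j =
     (if m = 0 then nodal y j
      else if m \<le> n div 2 then even_part n (\<lambda>i. elt y j i + elt y (j + 1) i) m
      else odd_part n (\<lambda>i. elt y (j + 1) i - elt y j i) (m - n div 2))"

definition dir_weight :: "nat \<Rightarrow> (nat \<Rightarrow> real) \<Rightarrow> nat \<Rightarrow> real" where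
  "dir_weight n p m =
     (if m = 0 then 1
      else if m \<le> n div 2 then (if 2 * m = n then 1 else 2) * even_part n p m
      else 2 * odd_part n p (m - n div 2))"

end

(* The vectors s_0^(l) and s_k^(l) are pairwise orthogonal with respect to the mass operator, so
   the coefficients are quotients of inner products. Only the bisymmetry of the local matrices
   and discrete orthogonality of sines are needed for different k. A vector s_0^(l) against s_k^(m)
   gives a telescoping sum. For equal k the inner product reduces to a bilinear form in the vectors
   p; the spectral equation, after expansion of p in the inner eigenvectors, says that the forms of
   stiffness and mass are proportional with factor lambda_k^(l), so by symmetry the forms vanish for
   distinct eigenvalues. The norms are positive because the form is a convex combination of two
   values of the positive definite element mass form. *)

theory Submission
  imports "Jordan_Normal_Form.Determinant" Defs
begin

section \<open>Vectors and bisymmetric matrices\<close>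

text \<open>Linear independence of the s_k^(l) is not established separately: \<open>w\<close> comes
  with an expansion, and pairing it with one basis vector isolates one coefficient as soon as the
  norm is nonzero. This is the only place where definiteness of the mass matrix enters. The obstacle
  at equal k is that lambda_k^(l) is given by a rational equation and p_k^(l) by a linear system,
  with no direct statement that s_k^(l) is an eigenvector. The link is that testing the system with
  e^(m) yields the coefficients of p_k^(l), whose denominators are those of the equation;
  completeness of the e^(m) then identifies the sums in the equation with inner products of p_k^(l).
  The orthogonality for equal k is shown on the local form \<open>gram_form\<close>, which is what
  remains of a global inner product after the sums of sines have been evaluated; the global
  stiffness operator itself need not be handled. Vectors are functions on all of \<open>nat\<close>
  with information only at indices in \<open>{1..n-1}\<close>, so equalities between them are
  carried through congruence rules.\<close>

lemma sum_mirror: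
  fixes f :: "nat \<Rightarrow> real"
  shows "(\<Sum>i=1..n-1. f (n - i)) = (\<Sum>i=1..n-1. f i)"
  by (rule sum.reindex_bij_witness[where i="\<lambda>i. n - i" and j="\<lambda>i. n - i"]) auto

lemma mirror_mirror: "i \<le> n \<Longrightarrow> mirror n (mirror n q) i = q i"
  by (simp add: mirror_def)

lemma dot_cong:
  "(\<And>i. i \<in> {1..n-1} \<Longrightarrow> u i = u' i) \<Longrightarrow> (\<And>i. i \<in> {1..n-1} \<Longrightarrow> v i = v' i)
    \<Longrightarrow> dot n u v = dot n u' v'"
  unfolding dot_def by (intro sum.cong) auto

lemma dot_commute: "dot n u v = dot n v u"
  by (simp add: dot_def mult.commute)

lemma dot_add_left: "dot n (\<lambda>i. u i + v i) x = dot n u x + dot n v x"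
  by (simp add: dot_def algebra_simps sum.distrib)

lemma dot_add_right: "dot n x (\<lambda>i. u i + v i) = dot n x u + dot n x v"
  by (simp add: dot_def algebra_simps sum.distrib)

lemma dot_diff_left: "dot n (\<lambda>i. u i - v i) x = dot n u x - dot n v x"
  by (simp add: dot_def algebra_simps sum_subtractf)

lemma dot_diff_right: "dot n x (\<lambda>i. u i - v i) = dot n x u - dot n x v"
  by (simp add: dot_def algebra_simps sum_subtractf)

lemma dot_scale_left: "dot n (\<lambda>i. c * u i) x = c * dot n u x"
  by (simp add: dot_def sum_distrib_left mult.assoc)

lemma dot_scale_right: "dot n x (\<lambda>i. c * u i) = c * dot n x u"
  by (simp add: dot_def sum_distrib_left mult.left_commute)

lemma dot_scale_left': "dot n (\<lambda>i. u i * c) x = c * dot n u x"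
  by (simp add: dot_def sum_distrib_left mult_ac)

lemma dot_scale_right': "dot n x (\<lambda>i. u i * c) = c * dot n x u"
  by (simp add: dot_def sum_distrib_left mult_ac)

lemma dot_minus_left: "dot n (\<lambda>i. - u i) x = - dot n u x"
  by (simp add: dot_def sum_negf)

lemma dot_minus_right: "dot n x (\<lambda>i. - u i) = - dot n x u"
  by (simp add: dot_def sum_negf)

lemma dot_sum_left: "dot n (\<lambda>i. \<Sum>j\<in>J. f j i) x = (\<Sum>j\<in>J. dot n (f j) x)"
  unfolding dot_def sum_distrib_right by (rule sum.swap)

lemma dot_sum_right: "dot n x (\<lambda>i. \<Sum>j\<in>J. f j i) = (\<Sum>j\<in>J. dot n x (f j))"
  unfolding dot_def sum_distrib_left by (rule sum.swap)

lemmas dot_linear = dot_add_left dot_add_right dot_diff_left dot_diff_right dot_scale_left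
  dot_scale_right dot_scale_left' dot_scale_right' dot_minus_left dot_minus_right

lemma dot_mirror_right: "dot n u (mirror n v) = dot n (mirror n u) v"
  unfolding dot_def mirror_def
  by (rule sum.reindex_bij_witness[where i="\<lambda>i. n - i" and j="\<lambda>i. n - i"]) auto

lemma dot_mirror_mirror: "dot n (mirror n u) (mirror n v) = dot n u v"
  unfolding dot_def mirror_def by (rule sum_mirror)

text \<open>Truncated subtraction gives \<open>n - (n - i) = i\<close> only for
  \<open>i \<le> n\<close>; beyond that bound the mirror is no involution.\<close>

lemma neg_mirror_pow:
  assumes "i \<le> n"
  shows "(neg_mirror n ^^ m) q i = (if even m then q i else - mirror n q i)"
  using assms
proof (induction m arbitrary: i)
  case (Suc m)
  then show ?case by (simp add: neg_mirror_def mirror_def)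
qed simp

lemma dot_neg_mirror_pow_right:
  "dot n u ((neg_mirror n ^^ m) v) = dot n ((neg_mirror n ^^ m) u) v"
proof -
  have "dot n u ((neg_mirror n ^^ m) v) = dot n u (\<lambda>i. if even m then v i else - mirror n v i)"
    by (intro dot_cong) (auto simp: neg_mirror_pow)
  also have "\<dots> = dot n (\<lambda>i. if even m then u i else - mirror n u i) v"
    by (cases "even m") (simp_all add: dot_minus_right dot_minus_left dot_mirror_right)
  also have "\<dots> = dot n ((neg_mirror n ^^ m) u) v"
    by (intro dot_cong) (auto simp: neg_mirror_pow)
  finally show ?thesis .
qed

text \<open>A node touches its left element through the mirrored border vector and its right element
  through the plain one. Against the alternating powers the two contributions are opposite, which
  drives the cancellations for \<open>s_zero\<close>.\<close>

lemma dot_mirror_neg_mirror_pow: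
  "dot n (mirror n u) ((neg_mirror n ^^ m) v) = - dot n u ((neg_mirror n ^^ Suc m) v)"
proof -
  have "dot n (mirror n u) ((neg_mirror n ^^ m) v) = dot n u (mirror n ((neg_mirror n ^^ m) v))"
    by (simp add: dot_mirror_right)
  also have "\<dots> = dot n u (\<lambda>i. - (neg_mirror n ^^ Suc m) v i)"
    by (intro dot_cong) (auto simp: neg_mirror_def)
  finally show ?thesis by (simp add: dot_minus_right)
qed

text \<open>Splitting \<open>q\<close> by parity pairs \<open>u + v\<close> with its even part and
  \<open>u - v\<close> with its odd part; even and odd vectors are orthogonal, so only matching
  parities survive. In use, \<open>u\<close> and \<open>v\<close> are the values on the elements
  right and left of a node.\<close>

lemma dot_even_odd_parts:
  "dot n u q + dot n v (mirror n q)
     = dot n (even_part n q) (even_part n (\<lambda>i. v i + u i))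
       + dot n (odd_part n q) (odd_part n (\<lambda>i. u i - v i))"
proof -
  have ev: "even_part n f = (\<lambda>i. (1/2) * (f i + mirror n f i))" for f
    by (simp add: even_part_def fun_eq_iff)
  have od: "odd_part n f = (\<lambda>i. (1/2) * (f i - mirror n f i))" for f
    by (simp add: odd_part_def fun_eq_iff)
  have m: "mirror n (\<lambda>i. v i + u i) = (\<lambda>i. mirror n v i + mirror n u i)"
     "mirror n (\<lambda>i. u i - v i) = (\<lambda>i. mirror n u i - mirror n v i)"
    by (simp_all add: mirror_def fun_eq_iff)
  show ?thesis
    unfolding ev od m dot_linear dot_mirror_mirror
    by (simp add: dot_mirror_right algebra_simps dot_commute[of n q] dot_commute[of n "mirror n q"])
qed

text \<open>The index \<open>i\<close> is paired with \<open>n - i\<close>; a middle index is its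
  own partner and counts once. The second form serves products of odd vectors, which vanish in the
  middle.\<close>

lemma sum_symmetric_halves:
  fixes f :: "nat \<Rightarrow> real"
  assumes sym: "\<And>i. i \<in> {1..n-1} \<Longrightarrow> f (n - i) = f i"
  shows "(\<Sum>i=1..n-1. f i) = (\<Sum>i=1..n div 2. (if 2 * i = n then 1 else 2) * f i)"
    and "(\<And>i. 2 * i = n \<Longrightarrow> f i = 0) \<Longrightarrow> (\<Sum>i=1..n-1. f i) = (\<Sum>i=1..(n-1) div 2. 2 * f i)"
proof -
  \<comment> \<open>The middle set is a singleton for even \<open>n > 0\<close> and empty otherwise,
    which avoids a case distinction on parity; \<open>0 < i\<close> takes care of
    \<open>n = 0\<close>.\<close>
  have split: "{1..n-1} = {1..(n-1) div 2} \<union> ({n div 2 + 1..n-1} \<union> {i. 2 * i = n \<and> 0 < i})"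
    by auto
  have dj: "{1..(n-1) div 2} \<inter> ({n div 2 + 1..n-1} \<union> {i. 2 * i = n \<and> 0 < i}) = {}"
    "{n div 2 + 1..n-1} \<inter> {i. 2 * i = n \<and> 0 < i} = {}"
    by auto
  have fin: "finite {i. 2 * i = n \<and> 0 < i}"
    by (rule finite_subset[of _ "{..n}"]) auto
  have upper: "(\<Sum>i=n div 2 + 1..n-1. f i) = (\<Sum>i=1..(n-1) div 2. f i)"
    by (rule sum.reindex_bij_witness[where i="\<lambda>i. n - i" and j="\<lambda>i. n - i"]) (auto simp: sym)
  have eq: "(\<Sum>i=1..n-1. f i) = (\<Sum>i=1..(n-1) div 2. 2 * f i) + (\<Sum>i | 2 * i = n \<and> 0 < i. f i)"
    unfolding split using fin dj
    by (subst sum.union_disjoint; simp add: upper[simplified] sum.union_disjoint flip: sum_distrib_left)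
  have low: "{1..n div 2} = {1..(n-1) div 2} \<union> {i. 2 * i = n \<and> 0 < i}"
    by auto
  have "(\<Sum>i=1..n div 2. (if 2 * i = n then 1 else 2) * f i)
      = (\<Sum>i=1..(n-1) div 2. (if 2 * i = n then 1 else 2) * f i)
        + (\<Sum>i | 2 * i = n \<and> 0 < i. (if 2 * i = n then 1 else 2) * f i)"
    unfolding low using fin by (intro sum.union_disjoint) auto
  also have "(\<Sum>i=1..(n-1) div 2. (if 2 * i = n then 1 else 2) * f i) = (\<Sum>i=1..(n-1) div 2. 2 * f i)"
    by (intro sum.cong) auto
  finally show "(\<Sum>i=1..n-1. f i) = (\<Sum>i=1..n div 2. (if 2 * i = n then 1 else 2) * f i)"
    using eq by simp
  show "(\<Sum>i=1..n-1. f i) = (\<Sum>i=1..(n-1) div 2. 2 * f i)" if "\<And>i. 2 * i = n \<Longrightarrow> f i = 0"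
    using eq that by simp
qed

lemma even_part_mirror: "i \<le> n \<Longrightarrow> even_part n q (n - i) = even_part n q i"
  by (simp add: even_part_def mirror_def)

lemma odd_part_mirror: "i \<le> n \<Longrightarrow> odd_part n q (n - i) = - odd_part n q i"
  by (simp add: odd_part_def mirror_def field_simps)

lemma odd_part_middle: "2 * i = n \<Longrightarrow> odd_part n q i = 0"
proof -
  assume "2 * i = n"
  then have "n - i = i" by simp
  then show ?thesis by (simp add: odd_part_def mirror_def)
qed

lemma dot_even_even:
  "dot n (even_part n q) (even_part n r)
     = (\<Sum>i=1..n div 2. (if 2 * i = n then 1 else 2) * even_part n q i * even_part n r i)"
  unfolding dot_def
  by (subst sum_symmetric_halves(1)) (auto simp: even_part_mirror mult.assoc)

lemma dot_odd_odd:
  "dot n (odd_part n q) (odd_part n r)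
     = (\<Sum>i=1..(n-1) div 2. 2 * odd_part n q i * odd_part n r i)"
  unfolding dot_def
  by (subst sum_symmetric_halves(2)) (auto simp: odd_part_mirror odd_part_middle mult.assoc)

text \<open>Symmetry about both diagonals is what the block form of the local matrices expresses:
  two corner values, \<open>bvec M\<close> and its mirror fill the border, and the inner block
  commutes with the mirror.\<close>

definition bisym :: "nat \<Rightarrow> (nat \<Rightarrow> nat \<Rightarrow> real) \<Rightarrow> bool" where
  "bisym n M \<longleftrightarrow> (\<forall>k\<le>n. \<forall>l\<le>n. M k l = M l k \<and> M (n - k) (n - l) = M k l)"

lemma dot_inner_mult:
  assumes "bisym n M"
  shows "dot n (inner_mult n M u) v = dot n u (inner_mult n M v)"
proof -
  have "dot n (inner_mult n M u) v = (\<Sum>i=1..n-1. \<Sum>m=1..n-1. M i m * u m * v i)"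
    by (simp add: dot_def inner_mult_def sum_distrib_right)
  also have "\<dots> = (\<Sum>m=1..n-1. \<Sum>i=1..n-1. M m i * u m * v i)"
    using assms by (subst sum.swap, intro sum.cong) (auto simp: bisym_def)
  also have "\<dots> = dot n u (inner_mult n M v)"
    by (simp add: dot_def inner_mult_def sum_distrib_left mult_ac)
  finally show ?thesis .
qed

lemma inner_mult_cong:
  "(\<And>i. i \<in> {1..n-1} \<Longrightarrow> u i = v i) \<Longrightarrow> inner_mult n M u = inner_mult n M v"
  unfolding inner_mult_def by (intro ext sum.cong) auto

lemma inner_mult_add: "inner_mult n M (\<lambda>i. u i + v i) i = inner_mult n M u i + inner_mult n M v i"
  by (simp add: inner_mult_def algebra_simps sum.distrib)

lemma inner_mult_scale: "inner_mult n M (\<lambda>i. c * u i) i = c * inner_mult n M u i"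
  by (simp add: inner_mult_def sum_distrib_left mult_ac)

lemma inner_mult_scale': "inner_mult n M (\<lambda>i. u i * c) i = c * inner_mult n M u i"
  by (simp add: inner_mult_def sum_distrib_left mult_ac)

lemma inner_mult_minus: "inner_mult n M (\<lambda>i. - u i) i = - inner_mult n M u i"
  by (simp add: inner_mult_def sum_negf)

lemma inner_mult_sum: "inner_mult n M (\<lambda>i. \<Sum>j\<in>J. f j i) i = (\<Sum>j\<in>J. inner_mult n M (f j) i)"
  unfolding inner_mult_def sum_distrib_left by (rule sum.swap)

lemma inner_mult_mirror:
  assumes "bisym n M" "i \<le> n"
  shows "inner_mult n M (mirror n v) i = mirror n (inner_mult n M v) i"
proof -
  \<comment> \<open>Writing \<open>m\<close> as \<open>n - (n - m)\<close> makes the whole summand a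
    function of \<open>n - m\<close>, so that the sum can be reindexed.\<close>
  have "inner_mult n M (mirror n v) i = (\<Sum>m=1..n-1. M i (n - (n - m)) * v (n - m))"
    unfolding inner_mult_def mirror_def by (intro sum.cong) auto
  also have "\<dots> = (\<Sum>m=1..n-1. M i (n - m) * v m)"
    by (rule sum_mirror[of "\<lambda>m. M i (n - m) * v m"])
  also have "\<dots> = (\<Sum>m=1..n-1. M (n - i) m * v m)"
  proof (intro sum.cong refl)
    fix m assume "m \<in> {1..n-1}"
    then have "M (n - i) (n - (n - m)) = M i (n - m)" "n - (n - m) = m"
      using assms unfolding bisym_def by auto
    then show "M i (n - m) * v m = M (n - i) m * v m"
      by simp
  qed
  finally show ?thesis by (simp add: inner_mult_def mirror_def)
qed

lemma inner_mult_neg_mirror_pow: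
  assumes "bisym n M" "i \<le> n"
  shows "inner_mult n M ((neg_mirror n ^^ m) v) i = (neg_mirror n ^^ m) (inner_mult n M v) i"
proof -
  have "inner_mult n M ((neg_mirror n ^^ m) v) i
      = inner_mult n M (\<lambda>i. if even m then v i else - mirror n v i) i"
    by (rule fun_cong[OF inner_mult_cong]) (auto simp: neg_mirror_pow)
  then show ?thesis
    using assms by (simp add: neg_mirror_pow inner_mult_minus inner_mult_mirror)
qed

section \<open>Local matrices and discrete sines\<close>

lemma node_mirror: "n \<ge> 1 \<Longrightarrow> k \<le> n \<Longrightarrow> node n (n - k) = - node n k"
  by (simp add: node_def of_nat_diff field_simps)

lemma node_bounds: "n \<ge> 1 \<Longrightarrow> k \<le> n \<Longrightarrow> node n k \<in> {-1..1}"
  by (simp add: node_def field_simps)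

lemma is_lagrange_lagrange: "n \<ge> 1 \<Longrightarrow> l \<le> n \<Longrightarrow> is_lagrange n l (lagrange n l)"
  unfolding lagrange_def by (rule theI') (rule ex1_lagrange)

text \<open>The nodes are symmetric about 0, so the reflected polynomial solves the mirrored
  interpolation problem, whose solution is unique.\<close>

lemma lagrange_mirror:
  assumes "n \<ge> 1" "l \<le> n"
  shows "lagrange n (n - l) = pcompose (lagrange n l) [:0, -1:]"
proof -
  have L: "is_lagrange n l (lagrange n l)"
    by (rule is_lagrange_lagrange[OF assms])
  have "is_lagrange n (n - l) (pcompose (lagrange n l) [:0, -1:])"
    unfolding is_lagrange_def
  proof (intro conjI ballI)
    show "degree (pcompose (lagrange n l) [:0, -1:]) \<le> n"
      using L by (simp add: is_lagrange_def degree_pcompose)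
    fix k assume k: "k \<in> {0..n}"
    have "poly (lagrange n l) (node n (n - k)) = (if n - k = l then 1 else 0)"
      using L k unfolding is_lagrange_def by simp
    moreover have "node n (n - k) = - node n k"
      using k assms by (intro node_mirror) auto
    moreover have "n - k = l \<longleftrightarrow> k = n - l"
      using k assms by auto
    ultimately show "poly (pcompose (lagrange n l) [:0, -1:]) (node n k) = (if k = n - l then 1 else 0)"
      by (simp add: poly_pcompose)
  qed
  then show ?thesis
    using ex1_lagrange[of n "n - l"] is_lagrange_lagrange[of n "n - l"] assms by auto
qed

lemma integral_mirror: "integral {-1..1} (\<lambda>x. f (- x)) = integral {-1..1::real} f"
  for f :: "real \<Rightarrow> real"
  using Henstock_Kurzweil_Integration.integral_reflect_real[of 1 "-1" f] by simp

lemma poly_lagrange_mirror: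
  assumes "n \<ge> 1" "l \<le> n"
  shows "poly (lagrange n (n - l)) x = poly (lagrange n l) (- x)"
    and "poly (pderiv (lagrange n (n - l))) x = - poly (pderiv (lagrange n l)) (- x)"
  by (simp_all add: lagrange_mirror[OF assms] pderiv_pcompose poly_pcompose pderiv_pCons)

lemma bisym_mass: "n \<ge> 1 \<Longrightarrow> bisym n (mass n)"
  unfolding bisym_def
proof (intro allI impI conjI)
  fix k l assume n: "n \<ge> 1" and kl: "k \<le> n" "l \<le> n"
  show "mass n k l = mass n l k"
    by (simp only: mass_def mult.commute)
  show "mass n (n - k) (n - l) = mass n k l"
    using integral_mirror[of "\<lambda>x. poly (lagrange n k) x * poly (lagrange n l) x"]
    by (simp only: mass_def poly_lagrange_mirror[OF n kl(1)] poly_lagrange_mirror[OF n kl(2)])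
qed

text \<open>Reflection changes the sign of both derivatives, and the two signs cancel.\<close>

lemma bisym_stiff: "n \<ge> 1 \<Longrightarrow> bisym n (stiff n)"
  unfolding bisym_def
proof (intro allI impI conjI)
  fix k l assume n: "n \<ge> 1" and kl: "k \<le> n" "l \<le> n"
  show "stiff n k l = stiff n l k"
    by (simp only: stiff_def mult.commute)
  show "stiff n (n - k) (n - l) = stiff n k l"
    using integral_mirror[of "\<lambda>x. poly (pderiv (lagrange n k)) x * poly (pderiv (lagrange n l)) x"]
    by (simp only: stiff_def poly_lagrange_mirror[OF n kl(1)] poly_lagrange_mirror[OF n kl(2)]
        minus_mult_minus)
qed

text \<open>The double sum is the integral of the square of the polynomial with nodal values
  \<open>v\<close>. A continuous nonnegative function with zero integral vanishes identically, but
  this one is nonzero at node \<open>k\<close>.\<close>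

lemma mass_pos_def:
  assumes n: "n \<ge> 1" and k: "k \<le> n" "v k \<noteq> 0"
  shows "(\<Sum>i=0..n. \<Sum>j=0..n. mass n i j * v i * v j) > 0"
proof -
  define f where "f x = (\<Sum>i=0..n. v i * poly (lagrange n i) x)" for x
  have cont: "continuous_on {-1..1} (\<lambda>x. (f x)\<^sup>2)"
    unfolding f_def by (intro continuous_intros)
  have "f (node n k) = (\<Sum>i=0..n. v i * (if k = i then 1 else 0))"
    unfolding f_def
  proof (intro sum.cong refl)
    fix i assume "i \<in> {0..n}"
    then show "v i * poly (lagrange n i) (node n k) = v i * (if k = i then 1 else 0)"
      using is_lagrange_lagrange[of n i] n k by (simp add: is_lagrange_def)
  qed
  also have "\<dots> = v k"
    using k by (simp add: if_distrib[of "\<lambda>x. v _ * x"] cong: if_cong)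
  finally have "\<not> (\<forall>x\<in>{-1..1}. (f x)\<^sup>2 = 0)"
    using k node_bounds[OF n k(1)] by (metis zero_eq_power2)
  then have "integral {-1..1} (\<lambda>x. (f x)\<^sup>2) \<noteq> 0"
    using integral_eq_0_iff[OF cont] by simp
  moreover have "integral {-1..1} (\<lambda>x. (f x)\<^sup>2) \<ge> 0"
    using cont by (intro integral_nonneg integrable_continuous_interval) auto
  moreover have "((\<lambda>x. (f x)\<^sup>2) has_integral (\<Sum>i=0..n. \<Sum>j=0..n. v i * v j * mass n i j)) {-1..1}"
  proof -
    have eq: "(f x)\<^sup>2 = (\<Sum>i=0..n. \<Sum>j=0..n. v i * v j * (poly (lagrange n i) x * poly (lagrange n j) x))" for x
      unfolding f_def power2_eq_square sum_product by (simp add: mult_ac)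
    show ?thesis
      unfolding eq mass_def
      by (intro has_integral_sum has_integral_mult_right integrable_integral
          integrable_continuous_interval continuous_intros) auto
  qed
  ultimately show ?thesis
    by (simp add: integral_unique mult_ac)
qed

section \<open>Orthogonality of the discrete sines\<close>

lemma sn_0 [simp]: "sn K k 0 = 0"
  by (simp add: sn_def)

lemma sn_K [simp]: "sn K k K = 0"
  by (cases "K = 0") (simp_all add: sn_def)

text \<open>Discrete sines are eigenvectors of the sum over both neighbours;
  \<open>theta K k\<close> is half the eigenvalue.\<close>

lemma sn_shift_sum: "j \<ge> 1 \<Longrightarrow> sn K k (j - 1) + sn K k (j + 1) = 2 * theta K k * sn K k j"
proof -
  assume "j \<ge> 1"
  let ?x = "pi * real k * real j / real K" and ?h = "pi * real k / real K"
  have "pi * real k * real (j - 1) / real K = ?x - ?h" "pi * real k * real (j + 1) / real K = ?x + ?h"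
    using \<open>j \<ge> 1\<close> by (simp_all add: of_nat_diff algebra_simps add_divide_distrib diff_divide_distrib)
  then show ?thesis
    unfolding sn_def theta_def by (simp only: sin_add sin_diff) simp
qed

text \<open>Element sums run to \<open>K\<close> and nodal sums to \<open>K - 1\<close>. Values that
  vanish at the end points make the two interchangeable, up to a shift of the index.\<close>

lemma sum_boundary_left:
  fixes f :: "nat \<Rightarrow> real"
  assumes "f 0 = 0"
  shows "(\<Sum>j=1..K. f (j - 1)) = (\<Sum>j=1..K-1. f j)"
proof -
  have "(\<Sum>j=1..K. f (j - 1)) = (\<Sum>j<K. f j)"
    by (rule sum.reindex_bij_witness[where i=Suc and j="\<lambda>j. j - 1"]) auto
  also have "\<dots> = (\<Sum>j=1..K-1. f j)"
    using assms by (intro sum.mono_neutral_right) (auto simp: not_le less_Suc_eq)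
  finally show ?thesis .
qed

lemma sum_boundary_right:
  fixes f :: "nat \<Rightarrow> real"
  assumes "f K = 0"
  shows "(\<Sum>j=1..K. f j) = (\<Sum>j=1..K-1. f j)"
proof (rule sum.mono_neutral_right)
  show "\<forall>j\<in>{1..K} - {1..K-1}. f j = 0"
  proof
    fix j assume "j \<in> {1..K} - {1..K-1}"
    then have "j = K" by auto
    with assms show "f j = 0" by simp
  qed
qed auto

lemma sum_neighbour_products:
  fixes f g :: "nat \<Rightarrow> real"
  assumes "f 0 = 0" "f K = 0" "g 0 = 0" "g K = 0"
  shows "(\<Sum>j=1..K. f (j - 1) * g j) = (\<Sum>j=1..K-1. f (j - 1) * g j)"
    and "(\<Sum>j=1..K. f (j - 1) * g j) = (\<Sum>j=1..K-1. f j * g (j + 1))"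
proof -
  show "(\<Sum>j=1..K. f (j - 1) * g j) = (\<Sum>j=1..K-1. f (j - 1) * g j)"
    using assms by (intro sum_boundary_right) simp
  have "(\<Sum>j=1..K. f (j - 1) * g j) = (\<Sum>j=1..K. f (j - 1) * g (j - 1 + 1))"
    by (intro sum.cong) auto
  also have "\<dots> = (\<Sum>j=1..K-1. f j * g (j + 1))"
    using assms by (intro sum_boundary_left[of "\<lambda>j. f j * g (j + 1)"]) simp
  finally show "(\<Sum>j=1..K. f (j - 1) * g j) = (\<Sum>j=1..K-1. f j * g (j + 1))" .
qed

text \<open>Moving one shift to the other factor puts both neighbours on \<open>sn K k\<close>,
  where the recurrence applies. The left-hand side is symmetric in \<open>k\<close> and
  \<open>m\<close> while the factor on the right depends on \<open>k\<close> alone; this forces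
  orthogonality.\<close>

lemma sum_sn_neighbour:
  "(\<Sum>j=1..K. sn K k (j - 1) * sn K m j) + (\<Sum>j=1..K. sn K k j * sn K m (j - 1))
     = 2 * theta K k * (\<Sum>j=1..K-1. sn K k j * sn K m j)"
proof -
  have "(\<Sum>j=1..K. sn K k (j - 1) * sn K m j) + (\<Sum>j=1..K. sn K m (j - 1) * sn K k j)
      = (\<Sum>j=1..K-1. sn K k (j - 1) * sn K m j) + (\<Sum>j=1..K-1. sn K m j * sn K k (j + 1))"
    by (simp only: sum_neighbour_products(1)[of "sn K k" K "sn K m"]
        sum_neighbour_products(2)[of "sn K m" K "sn K k"] sn_0 sn_K)
  also have "\<dots> = (\<Sum>j=1..K-1. (sn K k (j - 1) + sn K k (j + 1)) * sn K m j)"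
    by (simp add: sum.distrib[symmetric] algebra_simps)
  also have "\<dots> = (\<Sum>j=1..K-1. 2 * theta K k * (sn K k j * sn K m j))"
    by (intro sum.cong refl) (simp only: sn_shift_sum atLeastAtMost_iff mult.assoc)
  finally show ?thesis
    by (simp add: sum_distrib_left mult_ac)
qed

lemma theta_inj:
  assumes "k \<in> {1..K-1}" "m \<in> {1..K-1}" "theta K k = theta K m"
  shows "k = m"
proof -
  have K: "K > 0" using assms by auto
  have b: "0 \<le> pi * real i / real K \<and> pi * real i / real K \<le> pi" if "i \<in> {1..K-1}" for i
  proof -
    have "i \<le> K" using that by auto
    then have "pi * (real i / real K) \<le> pi * 1"
      using K by (intro mult_left_mono) auto
    then show ?thesis by simp
  qed
  have "pi * real k / real K = pi * real m / real K"
  proof (rule cos_inj_pi)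
    show "cos (pi * real k / real K) = cos (pi * real m / real K)"
      using assms(3) by (simp only: theta_def)
  qed (use b[OF assms(1)] b[OF assms(2)] in blast)+
  then show ?thesis using K by simp
qed

lemma theta_bounds: "\<bar>theta K k\<bar> \<le> 1"
  by (simp add: theta_def)

lemma sum_sn_squared:
  assumes "k \<in> {1..K-1}"
  shows "(\<Sum>j=1..K-1. (sn K k j)\<^sup>2) = real K / 2"
proof -
  have K: "K > 0" using assms by auto
  define x where "x = pi * real k / real K"
  have "k < K" using assms by auto
  then have "pi * (real k / real K) < pi * 1"
    using K by (intro mult_strict_left_mono) auto
  then have x: "0 < x" "x < pi" using assms K by (simp_all add: x_def)
  then have sx: "sin x > 0" by (rule sin_gt_zero)
  have Kx: "real K * x = pi * real k" using K by (simp add: x_def)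
  \<comment> \<open>The factor \<open>2 * sin x\<close> makes the cosine sum telescope; both end
    terms equal \<open>- sin x\<close> because \<open>real K * x\<close> is a multiple of
    \<open>pi\<close>.\<close>
  have "2 * sin x * (\<Sum>j<K. cos (2 * x * real j))
      = (\<Sum>j<K. sin (2 * x * real (Suc j) - x) - sin (2 * x * real j - x))"
    unfolding sum_distrib_left
  proof (intro sum.cong refl)
    fix j
    have "2 * x * real (Suc j) - x = 2 * x * real j + x" by (simp add: algebra_simps)
    then show "2 * sin x * cos (2 * x * real j) = sin (2 * x * real (Suc j) - x) - sin (2 * x * real j - x)"
      by (simp only: sin_add sin_diff) simp
  qed
  also have "\<dots> = sin (2 * x * real K - x) - sin (2 * x * real 0 - x)"
    by (rule sum_lessThan_telescope)
  also have "2 * x * real K - x = 2 * pi * real k - x" using Kx by (simp add: mult_ac)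
  also have "sin \<dots> = - sin x"
    using sin_2npi[of k] cos_2npi[of k] by (simp add: sin_diff mult_ac)
  finally have c: "(\<Sum>j<K. cos (2 * x * real j)) = 0"
    using sx by simp
  have "(\<Sum>j=1..K-1. (sn K k j)\<^sup>2) = (\<Sum>j<K. (sn K k j)\<^sup>2)"
    by (rule sum.mono_neutral_left) (auto simp: not_le less_Suc_eq)
  also have "\<dots> = (\<Sum>j<K. 1 / 2 - cos (2 * x * real j) / 2)"
  proof (intro sum.cong refl)
    fix j
    have "sn K k j = sin (x * real j)" by (simp add: sn_def x_def)
    moreover have "cos (2 * x * real j) = 1 - 2 * (sin (x * real j))\<^sup>2"
      using cos_double_sin[of "x * real j"] by (simp add: mult_ac)
    ultimately show "(sn K k j)\<^sup>2 = 1 / 2 - cos (2 * x * real j) / 2" by (simp add: field_simps)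
  qed
  also have "\<dots> = real K / 2"
    by (simp add: sum_subtractf c flip: sum_divide_distrib)
  finally show ?thesis .
qed

lemma sum_sn_orthogonal:
  assumes "k \<in> {1..K-1}" "m \<in> {1..K-1}"
  shows "(\<Sum>j=1..K-1. sn K k j * sn K m j) = (if k = m then real K / 2 else 0)"
proof (cases "k = m")
  case True
  then show ?thesis using sum_sn_squared[OF assms(1)] by (simp add: power2_eq_square)
next
  case False
  \<comment> \<open>These rewrites align the instance with \<open>k\<close> and \<open>m\<close>
    exchanged, up to the order of the two left-hand sums; the two instances then differ only in the
    value of theta.\<close>
  have "(\<Sum>j=1..K-1. sn K m j * sn K k j) = (\<Sum>j=1..K-1. sn K k j * sn K m j)"
    "(\<Sum>j=1..K. sn K m (j - 1) * sn K k j) = (\<Sum>j=1..K. sn K k j * sn K m (j - 1))"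
    "(\<Sum>j=1..K. sn K m j * sn K k (j - 1)) = (\<Sum>j=1..K. sn K k (j - 1) * sn K m j)"
    by (simp_all only: mult.commute)
  from sum_sn_neighbour[of K m k, unfolded this]
  have "theta K k * (\<Sum>j=1..K-1. sn K k j * sn K m j) = theta K m * (\<Sum>j=1..K-1. sn K k j * sn K m j)"
    using sum_sn_neighbour[of K k m] unfolding mult.assoc by linarith
  then show ?thesis using theta_inj[OF assms] False by auto
qed

section \<open>Gram matrix of the global basis\<close>

lemma sum_boundary_shift:
  fixes f :: "nat \<Rightarrow> real"
  assumes "f 0 = 0" "f K = 0"
  shows "(\<Sum>j=1..K. f (j - 1)) = (\<Sum>j=1..K. f j)"
  using sum_boundary_left[of f K] sum_boundary_right[of f K] assms by simp

lemma dot_mirror_twice: "dot n (mirror n (mirror n u)) v = dot n u v"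
  by (intro dot_cong) (auto simp: mirror_mirror)

lemma SK_inner_glob_op_cong:
  assumes "SK_eq n K v w"
  shows "SK_inner n K (glob_op n K M v) u = SK_inner n K (glob_op n K M w) u"
proof -
  have nd: "nodal v j = nodal w j" if "j \<le> K" for j
    using assms that by (simp add: SK_eq_def)
  have el: "elt v j i = elt w j i" if "j \<in> {1..K}" "i \<in> {1..n-1}" for j i
    using assms that by (simp add: SK_eq_def)
  have im: "inner_mult n M (elt v j) = inner_mult n M (elt w j)" if "j \<in> {1..K}" for j
    using el that by (intro inner_mult_cong) auto
  have dt: "dot n x (elt v j) = dot n x (elt w j)" if "j \<in> {1..K}" for j x
    using el that by (intro dot_cong) auto
  have "nodal (glob_op n K M v) j = nodal (glob_op n K M w) j" for j
  proof (cases "j \<in> {1..K-1}")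
    case True
    then have "j \<in> {1..K}" "j + 1 \<in> {1..K}" "j - 1 \<le> K" "j \<le> K" "j + 1 \<le> K"
      by auto
    then show ?thesis unfolding glob_op_def by (simp add: nd dt)
  next
    case False
    then show ?thesis by (simp only: glob_op_def gfun.simps if_False)
  qed
  moreover have "elt (glob_op n K M v) j = elt (glob_op n K M w) j" if "j \<in> {1..K}" for j
  proof -
    have "j - 1 \<le> K" "j \<le> K" using that by auto
    then show ?thesis unfolding glob_op_def by (simp add: nd im[OF that])
  qed
  ultimately show ?thesis
    unfolding SK_inner_def by simp
qed

text \<open>Linearity in the shape of the induction step of a finite sum; it is stated on components
  because the records carry no vector space structure.\<close>

lemma SK_inner_glob_op_axpy:
  "SK_inner n K (glob_op n K M
      \<lparr>nodal = (\<lambda>j. a * nodal u j + nodal v j), elt = (\<lambda>j i. a * elt u j i + elt v j i)\<rparr>) x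
    = a * SK_inner n K (glob_op n K M u) x + SK_inner n K (glob_op n K M v) x"
proof -
  have "nodal (glob_op n K M
      \<lparr>nodal = (\<lambda>j. a * nodal u j + nodal v j), elt = (\<lambda>j i. a * elt u j i + elt v j i)\<rparr>) j
    = a * nodal (glob_op n K M u) j + nodal (glob_op n K M v) j" for j
    unfolding glob_op_def by (simp add: dot_linear algebra_simps)
  moreover have "elt (glob_op n K M
      \<lparr>nodal = (\<lambda>j. a * nodal u j + nodal v j), elt = (\<lambda>j i. a * elt u j i + elt v j i)\<rparr>) j
    = (\<lambda>i. a * elt (glob_op n K M u) j i + elt (glob_op n K M v) j i)" for j
    unfolding glob_op_def by (simp add: inner_mult_add inner_mult_scale algebra_simps)
  ultimately show ?thesis
    unfolding SK_inner_def
    by (simp add: dot_linear sum.distrib sum_distrib_left algebra_simps)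
qed

lemma SK_inner_glob_op_zero:
  "SK_inner n K (glob_op n K M \<lparr>nodal = (\<lambda>j. 0), elt = (\<lambda>j i. 0)\<rparr>) x = 0"
  by (simp add: SK_inner_def glob_op_def dot_def inner_mult_def)

lemma SK_inner_glob_op_sum:
  assumes "finite I"
  shows "SK_inner n K (glob_op n K M
      \<lparr>nodal = (\<lambda>j. \<Sum>q\<in>I. c q * nodal (t q) j), elt = (\<lambda>j i. \<Sum>q\<in>I. c q * elt (t q) j i)\<rparr>) x
    = (\<Sum>q\<in>I. c q * SK_inner n K (glob_op n K M (t q)) x)"
  using assms
proof (induction I rule: finite_induct)
  case empty
  show ?case by (simp add: SK_inner_glob_op_zero)
next
  case (insert a I)
  then show ?case
    using SK_inner_glob_op_axpy[of n K M "c a" "t a"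
        "\<lparr>nodal = (\<lambda>j. \<Sum>q\<in>I. c q * nodal (t q) j), elt = (\<lambda>j i. \<Sum>q\<in>I. c q * elt (t q) j i)\<rparr>" x]
    by simp
qed

lemma SK_inner_glob_op_expansion:
  "SK_inner n K (glob_op n K M (expansion n K wc s)) x
    = (\<Sum>l=1..n-1. wc 0 l * SK_inner n K (glob_op n K M (s 0 l)) x)
      + (\<Sum>k=1..K-1. \<Sum>l=1..n. wc k l * SK_inner n K (glob_op n K M (s k l)) x)"
proof -
  \<comment> \<open>Both families are indexed by one set of pairs, disjoint since
    \<open>k = 0\<close> marks the first family, so that a single finite sum covers the
    expansion.\<close>
  define I where "I = ({0} \<times> {1..n-1}) \<union> ({1..K-1} \<times> {1..n})"
  have dj: "({0} \<times> {1..n-1}) \<inter> ({1..K-1} \<times> {1..n}) = {}" by auto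
  have sum_I: "(\<Sum>q\<in>I. f (fst q) (snd q)) = (\<Sum>l=1..n-1. f 0 l) + (\<Sum>k=1..K-1. \<Sum>l=1..n. f k l)"
    for f :: "nat \<Rightarrow> nat \<Rightarrow> real"
    unfolding I_def using dj
    by (subst sum.union_disjoint) (auto simp: sum.cartesian_product' simp flip: sum.cartesian_product)
  have "expansion n K wc s
      = \<lparr>nodal = (\<lambda>j. \<Sum>q\<in>I. wc (fst q) (snd q) * nodal (s (fst q) (snd q)) j),
         elt = (\<lambda>j i. \<Sum>q\<in>I. wc (fst q) (snd q) * elt (s (fst q) (snd q)) j i)\<rparr>"
    unfolding expansion_def
    by (simp add: sum_I[of "\<lambda>k l. wc k l * nodal (s k l) _"] sum_I[of "\<lambda>k l. wc k l * elt (s k l) _ _"])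
  moreover have "finite I" by (simp add: I_def)
  ultimately show ?thesis
    by (simp add: SK_inner_glob_op_sum
        sum_I[of "\<lambda>k l. wc k l * SK_inner n K (glob_op n K M (s k l)) x"])
qed

section \<open>Inner products between the two families of basis vectors\<close>

lemma SK_inner_s_zero:
  assumes M: "bisym n M" and K: "K \<ge> 1" and w: "nodal w 0 = 0" "nodal w K = 0"
  shows "SK_inner n K (glob_op n K M w) (s_zero n f)
    = dot n (inner_mult n M (\<lambda>i. \<Sum>j=1..K. (neg_mirror n ^^ (j - 1)) (elt w j) i)) f"
proof -
  \<comment> \<open>\<open>h j\<close> is the contribution of node \<open>j\<close> through the
    element on its right; through the element on its left it contributes
    \<open>- h j\<close>.\<close>
  define h where "h j = nodal w j * dot n (bvec M) ((neg_mirror n ^^ j) f)" for j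
  have el: "dot n (elt (glob_op n K M w) j) ((neg_mirror n ^^ (j - 1)) f)
      = (h (j - 1) - h j) + dot n (inner_mult n M ((neg_mirror n ^^ (j - 1)) (elt w j))) f"
    if "j \<in> {1..K}" for j
  proof -
    have j: "Suc (j - 1) = j" using that by simp
    have "dot n (inner_mult n M ((neg_mirror n ^^ (j - 1)) (elt w j))) f
        = dot n (inner_mult n M (elt w j)) ((neg_mirror n ^^ (j - 1)) f)"
      unfolding dot_neg_mirror_pow_right
      by (intro dot_cong inner_mult_neg_mirror_pow[OF M]) auto
    moreover have "dot n (mirror n (bvec M)) ((neg_mirror n ^^ (j - 1)) f)
        = - dot n (bvec M) ((neg_mirror n ^^ j) f)"
      using dot_mirror_neg_mirror_pow[of n "bvec M" "j - 1" f] unfolding j .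
    ultimately show ?thesis
      unfolding h_def glob_op_def gfun.simps dot_linear by simp
  qed
  have "SK_inner n K (glob_op n K M w) (s_zero n f)
      = (\<Sum>j=1..K. dot n (elt (glob_op n K M w) j) ((neg_mirror n ^^ (j - 1)) f))"
    by (simp add: SK_inner_def s_zero_def)
  also have "\<dots> = (\<Sum>j=1..K. (h (j - 1) - h j)
      + dot n (inner_mult n M ((neg_mirror n ^^ (j - 1)) (elt w j))) f)"
    by (intro sum.cong refl el)
  also have "\<dots> = (\<Sum>j=1..K. h (j - 1)) - (\<Sum>j=1..K. h j)
      + (\<Sum>j=1..K. dot n (inner_mult n M ((neg_mirror n ^^ (j - 1)) (elt w j))) f)"
    by (simp add: sum.distrib sum_subtractf)
  also have "(\<Sum>j=1..K. h (j - 1)) = (\<Sum>j=1..K. h j)"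
    using w by (intro sum_boundary_shift) (simp_all add: h_def)
  finally show ?thesis
    by (simp only: dot_sum_left[symmetric] inner_mult_sum[abs_def])
qed

text \<open>The sign and the mirror occur twice in each element and cancel, so all \<open>K\<close>
  elements contribute equally.\<close>

lemma s_zero_gram:
  assumes "bisym n M" "K \<ge> 1"
  shows "SK_inner n K (glob_op n K M (s_zero n f)) (s_zero n g) = real K * dot n (inner_mult n M f) g"
proof -
  have "(neg_mirror n ^^ (j - 1)) ((neg_mirror n ^^ (j - 1)) f) i = f i" if "i \<in> {1..n-1}" for i j
    using neg_mirror_pow[of i n "(j - 1) + (j - 1)" f] that by (simp only: funpow_add o_apply) auto
  then have "inner_mult n M (\<lambda>i. \<Sum>j=1..K. (neg_mirror n ^^ (j - 1)) (elt (s_zero n f) j) i)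
      = inner_mult n M (\<lambda>i. real K * f i)"
    by (intro inner_mult_cong) (simp add: s_zero_def)
  also have "\<dots> = (\<lambda>i. real K * inner_mult n M f i)"
    by (intro ext inner_mult_scale)
  finally show ?thesis
    using SK_inner_s_zero[OF assms, of "s_zero n f" g]
    by (simp add: dot_scale_left) (simp add: s_zero_def)
qed

text \<open>The sine vanishes at both ends by itself, so the case distinction in
  \<open>s_pos\<close> disappears.\<close>

lemma s_pos_nodal: "j \<le> K \<Longrightarrow> nodal (s_pos n K k q) j = sn K k j"
  by (cases "j = K"; cases "j = 0") (auto simp: s_pos_def)

text \<open>The element sum is regrouped by nodes: \<open>sn K k j\<close> multiplies
  \<open>q\<close> on the element to the right of node \<open>j\<close> and its mirror on the
  element to the left.\<close>

lemma SK_inner_s_pos: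
  "SK_inner n K v (s_pos n K k q)
    = (\<Sum>j=1..K-1. nodal v j * sn K k j)
      + (\<Sum>j=1..K-1. (dot n (elt v (j + 1)) q + dot n (elt v j) (mirror n q)) * sn K k j)"
proof -
  \<comment> \<open>The form \<open>j - 1 + 1\<close> exhibits the first summand as a function of
    \<open>j - 1\<close>, ready for the shift.\<close>
  have "(\<Sum>j=1..K. dot n (elt v j) (elt (s_pos n K k q) j))
      = (\<Sum>j=1..K. dot n (elt v (j - 1 + 1)) q * sn K k (j - 1))
        + (\<Sum>j=1..K. dot n (elt v j) (mirror n q) * sn K k j)"
    unfolding sum.distrib[symmetric]
    by (intro sum.cong refl) (simp add: s_pos_def dot_linear mult_ac)
  also have "(\<Sum>j=1..K. dot n (elt v (j - 1 + 1)) q * sn K k (j - 1))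
      = (\<Sum>j=1..K-1. dot n (elt v (j + 1)) q * sn K k j)"
    by (rule sum_boundary_left[of "\<lambda>j. dot n (elt v (j + 1)) q * sn K k j"]) simp
  also have "(\<Sum>j=1..K. dot n (elt v j) (mirror n q) * sn K k j)
      = (\<Sum>j=1..K-1. dot n (elt v j) (mirror n q) * sn K k j)"
    by (rule sum_boundary_right) simp
  also have "(\<Sum>j=1..K-1. dot n (elt v (j + 1)) q * sn K k j) + \<dots>
      = (\<Sum>j=1..K-1. (dot n (elt v (j + 1)) q + dot n (elt v j) (mirror n q)) * sn K k j)"
    by (simp add: sum.distrib distrib_right)
  finally have "(\<Sum>j=1..K. dot n (elt v j) (elt (s_pos n K k q) j))
      = (\<Sum>j=1..K-1. (dot n (elt v (j + 1)) q + dot n (elt v j) (mirror n q)) * sn K k j)" .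
  moreover have "(\<Sum>j=1..K-1. nodal v j * nodal (s_pos n K k q) j) = (\<Sum>j=1..K-1. nodal v j * sn K k j)"
    by (intro sum.cong refl) (simp add: s_pos_def)
  ultimately show ?thesis by (simp add: SK_inner_def)
qed

text \<open>Applied to \<open>s_pos\<close>, the global operator multiplies the nodal sine by twice
  this number.\<close>

definition node_form :: "nat \<Rightarrow> (nat \<Rightarrow> nat \<Rightarrow> real) \<Rightarrow> real \<Rightarrow> (nat \<Rightarrow> real) \<Rightarrow> real" where
  "node_form n M \<theta> q = M 0 0 + M 0 n * \<theta> + dot n (bvec M) q + \<theta> * dot n (mirror n (bvec M)) q"

text \<open>The global inner product of two \<open>s_pos\<close> vectors of the same frequency,
  divided by \<open>K\<close>. It is affine in each of \<open>q\<close> and \<open>r\<close>, the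
  nodal value 1 being built in.\<close>

definition gram_form ::
  "nat \<Rightarrow> (nat \<Rightarrow> nat \<Rightarrow> real) \<Rightarrow> real \<Rightarrow> (nat \<Rightarrow> real) \<Rightarrow> (nat \<Rightarrow> real) \<Rightarrow> real" where
  "gram_form n M \<theta> q r = node_form n M \<theta> q
     + dot n (\<lambda>i. bvec M i + inner_mult n M q i) r
     + \<theta> * dot n (\<lambda>i. bvec M i + inner_mult n M q i) (mirror n r)"

lemma glob_op_s_pos_nodal:
  assumes "j \<in> {1..K-1}"
  shows "nodal (glob_op n K M (s_pos n K k q)) j = 2 * node_form n M (theta K k) q * sn K k j"
proof -
  have j: "j - 1 \<le> K" "j \<le> K" "j + 1 \<le> K" "j \<ge> 1" using assms by auto
  have "nodal (glob_op n K M (s_pos n K k q)) j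
      = M 0 n * (sn K k (j - 1) + sn K k (j + 1)) + 2 * M 0 0 * sn K k j
        + dot n (mirror n (bvec M)) q * (sn K k (j - 1) + sn K k (j + 1))
        + 2 * dot n (bvec M) q * sn K k j"
    using assms unfolding glob_op_def
    by (simp add: s_pos_nodal[OF j(1), simplified] s_pos_nodal[OF j(2)] s_pos_nodal[OF j(3), simplified])
      (simp add: s_pos_def dot_linear dot_mirror_twice dot_mirror_right algebra_simps)
  then show ?thesis
    unfolding sn_shift_sum[OF j(4)] node_form_def by (simp add: algebra_simps)
qed

lemma glob_op_s_pos_elt:
  assumes M: "bisym n M" and j: "j \<in> {1..K}" and i: "i \<in> {1..n-1}"
  shows "elt (glob_op n K M (s_pos n K k q)) j i
    = (bvec M i + inner_mult n M q i) * sn K k (j - 1)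
      + mirror n (\<lambda>i. bvec M i + inner_mult n M q i) i * sn K k j"
proof -
  have j': "j - 1 \<le> K" "j \<le> K" using j by auto
  have "i \<le> n" using i by auto
  then have "inner_mult n M (elt (s_pos n K k q) j) i
      = inner_mult n M q i * sn K k (j - 1) + mirror n (inner_mult n M q) i * sn K k j"
    by (simp add: s_pos_def inner_mult_add inner_mult_scale' inner_mult_mirror[OF M])
  then show ?thesis
    unfolding glob_op_def gfun.simps s_pos_nodal[OF j'(1)] s_pos_nodal[OF j'(2)]
    by (simp add: mirror_def algebra_simps)
qed

lemma s_pos_gram:
  assumes M: "bisym n M" and k: "k \<in> {1..K-1}" and m: "m \<in> {1..K-1}"
  shows "SK_inner n K (glob_op n K M (s_pos n K k q)) (s_pos n K m r)
    = (if k = m then real K * gram_form n M (theta K k) q r else 0)"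
proof -
  define u where "u = (\<lambda>i. bvec M i + inner_mult n M q i)"
  define S where "S = (\<Sum>j=1..K-1. sn K k j * sn K m j)"
  have "SK_inner n K (glob_op n K M (s_pos n K k q)) (s_pos n K m r)
    = (\<Sum>j=1..K-1. nodal (glob_op n K M (s_pos n K k q)) j * sn K m j)
      + (\<Sum>j=1..K. dot n (elt (glob_op n K M (s_pos n K k q)) j) (elt (s_pos n K m r) j))"
    unfolding SK_inner_def by (simp add: s_pos_def)
  also have "(\<Sum>j=1..K-1. nodal (glob_op n K M (s_pos n K k q)) j * sn K m j)
      = 2 * node_form n M (theta K k) q * S"
    unfolding S_def sum_distrib_left
    by (intro sum.cong refl) (simp only: glob_op_s_pos_nodal mult.assoc)
  also have "(\<Sum>j=1..K. dot n (elt (glob_op n K M (s_pos n K k q)) j) (elt (s_pos n K m r) j))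
      = (\<Sum>j=1..K. dot n (\<lambda>i. u i * sn K k (j - 1) + mirror n u i * sn K k j)
            (\<lambda>i. r i * sn K m (j - 1) + mirror n r i * sn K m j))"
    unfolding u_def
    by (intro sum.cong refl dot_cong glob_op_s_pos_elt[OF M]) (auto simp: s_pos_def)
  \<comment> \<open>The mirror is an isometry, which gives both equal-index products the same
    coefficient, and self-adjoint, which does so for both mixed products. The mixed sums only need
    to be known in total.\<close>
  also have "\<dots> = (\<Sum>j=1..K. dot n u r * (sn K k (j - 1) * sn K m (j - 1))
      + dot n u r * (sn K k j * sn K m j)
      + dot n u (mirror n r) * (sn K k (j - 1) * sn K m j)
      + dot n u (mirror n r) * (sn K k j * sn K m (j - 1)))"
    by (intro sum.cong refl) (simp add: dot_linear dot_mirror_twice dot_mirror_right algebra_simps)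
  also have "\<dots> = dot n u r * (\<Sum>j=1..K. sn K k (j - 1) * sn K m (j - 1))
      + dot n u r * (\<Sum>j=1..K. sn K k j * sn K m j)
      + dot n u (mirror n r) * ((\<Sum>j=1..K. sn K k (j - 1) * sn K m j)
                                 + (\<Sum>j=1..K. sn K k j * sn K m (j - 1)))"
    by (simp only: sum.distrib sum_distrib_left distrib_left)
  also have "(\<Sum>j=1..K. sn K k (j - 1) * sn K m (j - 1)) = S"
    unfolding S_def by (rule sum_boundary_left[of "\<lambda>j. sn K k j * sn K m j"]) simp
  also have "(\<Sum>j=1..K. sn K k j * sn K m j) = S"
    unfolding S_def by (rule sum_boundary_right) simp
  also have "(\<Sum>j=1..K. sn K k (j - 1) * sn K m j) + (\<Sum>j=1..K. sn K k j * sn K m (j - 1))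
      = 2 * theta K k * S"
    unfolding S_def by (rule sum_sn_neighbour)
  finally have "SK_inner n K (glob_op n K M (s_pos n K k q)) (s_pos n K m r)
      = 2 * S * gram_form n M (theta K k) q r"
    unfolding gram_form_def u_def[symmetric] by (simp add: algebra_simps)
  moreover have "2 * S = (if k = m then real K else 0)"
    unfolding S_def using sum_sn_orthogonal[OF k m] by simp
  ultimately show ?thesis by simp
qed

text \<open>The alternating sum of the element values telescopes to zero in every component, so the
  result holds for arbitrary \<open>f\<close>.\<close>

lemma s_pos_s_zero_orthogonal:
  assumes M: "bisym n M" and K: "K \<ge> 1"
  shows "SK_inner n K (glob_op n K M (s_pos n K k q)) (s_zero n f) = 0"
proof -
  have "(\<Sum>j=1..K. (neg_mirror n ^^ (j - 1)) (elt (s_pos n K k q) j) i) = 0" if i: "i \<in> {1..n-1}" for i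
  proof -
    define h where "h j = (neg_mirror n ^^ j) q i * sn K k j" for j
    have "(neg_mirror n ^^ (j - 1)) (elt (s_pos n K k q) j) i = h (j - 1) - h j" if "j \<in> {1..K}" for j
    proof -
      have "even j \<longleftrightarrow> odd (j - 1)" using that by auto
      then show ?thesis
        using i unfolding h_def
        by (auto simp: neg_mirror_pow s_pos_def mirror_def)
    qed
    then have "(\<Sum>j=1..K. (neg_mirror n ^^ (j - 1)) (elt (s_pos n K k q) j) i)
        = (\<Sum>j=1..K. h (j - 1)) - (\<Sum>j=1..K. h j)"
      by (simp add: sum_subtractf)
    also have "\<dots> = 0"
      using sum_boundary_shift[of h K] by (simp add: h_def)
    finally show ?thesis .
  qed
  then have "inner_mult n M (\<lambda>i. \<Sum>j=1..K. (neg_mirror n ^^ (j - 1)) (elt (s_pos n K k q) j) i)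
      = inner_mult n M (\<lambda>i. 0)"
    by (intro inner_mult_cong) simp
  then show ?thesis
    using SK_inner_s_zero[OF M K, of "s_pos n K k q" f]
    by (simp add: s_pos_nodal) (simp add: s_pos_def inner_mult_def dot_def)
qed

text \<open>With the operator on the other factor the cancellation is local: at each node the border
  terms cancel, and so do the terms of the two adjacent elements.\<close>

lemma s_zero_s_pos_orthogonal:
  assumes M: "bisym n M"
  shows "SK_inner n K (glob_op n K M (s_zero n f)) (s_pos n K k q) = 0"
proof -
  have "nodal (glob_op n K M (s_zero n f)) j = 0" for j
  proof (cases "j \<in> {1..K-1}")
    case True
    then have "dot n (mirror n (bvec M)) ((neg_mirror n ^^ (j - 1)) f)
        = - dot n (bvec M) ((neg_mirror n ^^ j) f)"
      using dot_mirror_neg_mirror_pow[of n "bvec M" "j - 1" f] by simp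
    then show ?thesis using True by (simp add: glob_op_def s_zero_def)
  next
    case False
    then show ?thesis by (simp only: glob_op_def gfun.simps if_False)
  qed
  moreover have "dot n (elt (glob_op n K M (s_zero n f)) (j + 1)) q
      + dot n (elt (glob_op n K M (s_zero n f)) j) (mirror n q) = 0" if "j \<in> {1..K-1}" for j
  proof -
    have el: "dot n (elt (glob_op n K M (s_zero n f)) i) x
        = dot n ((neg_mirror n ^^ (i - 1)) (inner_mult n M f)) x" for i x
    proof (intro dot_cong refl)
      fix m assume "m \<in> {1..n-1}"
      then have "m \<le> n" by auto
      then show "elt (glob_op n K M (s_zero n f)) i m = (neg_mirror n ^^ (i - 1)) (inner_mult n M f) m"
        by (simp add: glob_op_def s_zero_def inner_mult_neg_mirror_pow[OF M])
    qed
    have "dot n ((neg_mirror n ^^ (j - 1)) (inner_mult n M f)) (mirror n q)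
        = - dot n ((neg_mirror n ^^ j) (inner_mult n M f)) q"
    proof -
      have "Suc (j - 1) = j" using that by simp
      then show ?thesis
        using dot_mirror_neg_mirror_pow[of n q "j - 1" "inner_mult n M f"]
        by (simp only: dot_commute[of n _ q] dot_commute[of n _ "mirror n q"])
    qed
    then show ?thesis by (simp add: el)
  qed
  ultimately show ?thesis
    by (simp add: SK_inner_s_pos)
qed

section \<open>Spectral equation and positivity\<close>

lemma gram_form_commute:
  assumes "bisym n M"
  shows "gram_form n M \<theta> q r = gram_form n M \<theta> r q"
proof -
  have "dot n (inner_mult n M q) (mirror n r) = dot n (inner_mult n M (mirror n r)) q"
    by (simp only: dot_inner_mult[OF assms] dot_commute[of n q])
  also have "\<dots> = dot n (mirror n (inner_mult n M r)) q"
    by (intro dot_cong inner_mult_mirror[OF assms]) auto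
  also have "\<dots> = dot n (inner_mult n M r) (mirror n q)"
    by (simp only: dot_mirror_right)
  finally show ?thesis
    unfolding gram_form_def node_form_def dot_linear
    by (simp add: dot_inner_mult[OF assms, of q r] dot_commute[of n q] dot_mirror_right[of n "bvec M"]
        algebra_simps)
qed

lemma gram_form_diff:
  "gram_form n (\<lambda>i j. A i j - \<mu> * C i j) \<theta> q r
     = gram_form n A \<theta> q r - \<mu> * gram_form n C \<theta> q r"
proof -
  have "bvec (\<lambda>i j. A i j - \<mu> * C i j) = (\<lambda>i. bvec A i - \<mu> * bvec C i)"
    by (simp add: bvec_def fun_eq_iff)
  moreover have "mirror n (\<lambda>i. bvec A i - \<mu> * bvec C i) = (\<lambda>i. mirror n (bvec A) i - \<mu> * mirror n (bvec C) i)"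
    by (simp add: mirror_def fun_eq_iff)
  moreover have "inner_mult n (\<lambda>i j. A i j - \<mu> * C i j) q
      = (\<lambda>i. inner_mult n A q i - \<mu> * inner_mult n C q i)"
    by (simp add: inner_mult_def fun_eq_iff left_diff_distrib sum_subtractf sum_distrib_left mult.assoc)
  ultimately show ?thesis
    unfolding gram_form_def node_form_def by (simp only: dot_linear) (simp add: algebra_simps)
qed

text \<open>The hypotheses are the nodal and element parts of the equation that \<open>M\<close>
  annihilates the vector built from \<open>q\<close>. For \<open>M\<close> a stiffness matrix minus
  \<open>\<mu>\<close> times a mass matrix, the conclusion is proportionality of the two
  forms.\<close>

lemma gram_form_eq_0:
  assumes "node_form n M \<theta> q = 0" "\<And>i. i \<in> {1..n-1} \<Longrightarrow> inner_mult n M q i = - bvec M i"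
  shows "gram_form n M \<theta> q r = 0"
proof -
  have "dot n (\<lambda>i. bvec M i + inner_mult n M q i) x = dot n (\<lambda>i. 0) x" for x
    using assms(2) by (intro dot_cong) auto
  then show ?thesis
    using assms(1) by (simp add: gram_form_def dot_def)
qed

lemma quadratic_form_blocks:
  assumes n: "n \<ge> 1" and M: "bisym n M"
  shows "(\<Sum>i=0..n. \<Sum>j=0..n. M i j * v i * v j)
    = M 0 0 * ((v 0)\<^sup>2 + (v n)\<^sup>2) + 2 * M 0 n * v 0 * v n
      + 2 * v 0 * dot n (bvec M) v + 2 * v n * dot n (mirror n (bvec M)) v
      + dot n (inner_mult n M v) v"
proof -
  have split: "(\<Sum>i=0..n. f i) = f 0 + f n + (\<Sum>i=1..n-1. f i)" for f :: "nat \<Rightarrow> real"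
  proof -
    have "{0..n} = insert 0 (insert n {1..n-1})" using n by auto
    then show ?thesis using n by simp
  qed
  have c: "M n n = M 0 0" "M n 0 = M 0 n"
    using M unfolding bisym_def by (metis diff_self_eq_0 diff_zero le0 order_refl)+
  \<comment> \<open>Bisymmetry reduces every border entry to the first column, hence to
    \<open>bvec M\<close>.\<close>
  have s: "M 0 i = M i 0" "M n i = M (n - i) 0" "M i n = M (n - i) 0" if "i \<in> {1..n-1}" for i
  proof -
    have i: "i \<le> n" using that by auto
    show "M 0 i = M i 0" using M i by (simp add: bisym_def)
    show "M i n = M (n - i) 0" using M i unfolding bisym_def by (metis diff_self_eq_0 order_refl)
    then show "M n i = M (n - i) 0" using M i unfolding bisym_def by (metis order_refl)
  qed
  have b: "(\<Sum>i=1..n-1. M 0 i * v i) = dot n (bvec M) v"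
    "(\<Sum>i=1..n-1. M n i * v i) = dot n (mirror n (bvec M)) v"
    "(\<Sum>i=1..n-1. M i 0 * v i) = dot n (bvec M) v"
    "(\<Sum>i=1..n-1. M i n * v i) = dot n (mirror n (bvec M)) v"
    unfolding dot_def bvec_def mirror_def by (intro sum.cong refl; simp only: s)+
  have "(\<Sum>i=0..n. \<Sum>j=0..n. M i j * v i * v j)
      = (\<Sum>i=0..n. v i * (M i 0 * v 0 + M i n * v n + (\<Sum>j=1..n-1. M i j * v j)))"
    unfolding split by (simp add: algebra_simps sum_distrib_left)
  also have "\<dots> = v 0 * (M 0 0 * v 0 + M 0 n * v n + dot n (bvec M) v)
      + v n * (M n 0 * v 0 + M n n * v n + dot n (mirror n (bvec M)) v)
      + ((\<Sum>i=1..n-1. M i 0 * v i) * v 0 + (\<Sum>i=1..n-1. M i n * v i) * v n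
         + dot n (inner_mult n M v) v)"
    unfolding split[of "\<lambda>i. v i * (M i 0 * v 0 + M i n * v n + (\<Sum>j=1..n-1. M i j * v j))"] b(1,2)
    by (simp add: sum_distrib_left sum_distrib_right sum.distrib algebra_simps dot_def inner_mult_def)
  finally show ?thesis
    unfolding b c by (simp add: algebra_simps power2_eq_square)
qed

text \<open>The form is affine in \<open>\<theta>\<close>, and at \<open>\<theta> = \<plusminus>1\<close> it is half the element mass form at the
  vector \<open>(1, q \<plusminus> mirror q, \<plusminus>1)\<close>.\<close>

lemma gram_form_mass_pos:
  assumes n: "n \<ge> 1" and \<theta>: "\<bar>\<theta>\<bar> \<le> 1"
  shows "gram_form n (mass n) \<theta> q q > 0"
proof -
  note M = bisym_mass[OF n]
  have ends: "gram_form n (mass n) \<sigma> q q > 0" if \<sigma>: "\<sigma> * \<sigma> = 1" for \<sigma>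
  proof -
    define r where "r = (\<lambda>i. q i + \<sigma> * mirror n q i)"
    define v where "v = (\<lambda>i. if i = 0 then 1 else if i = n then \<sigma> else r i)"
    have vr: "v i = r i" if "i \<in> {1..n-1}" for i
      using that by (auto simp: v_def)
    have dv: "dot n x v = dot n x r" for x
      by (intro dot_cong refl vr)
    have "dot n (inner_mult n (mass n) v) v
        = dot n (\<lambda>i. inner_mult n (mass n) q i + \<sigma> * mirror n (inner_mult n (mass n) q) i) r"
    proof (intro dot_cong vr)
      fix i assume "i \<in> {1..n-1}"
      then have "i \<le> n" by auto
      have "inner_mult n (mass n) v = inner_mult n (mass n) r"
        by (intro inner_mult_cong vr)
      then show "inner_mult n (mass n) v i
          = inner_mult n (mass n) q i + \<sigma> * mirror n (inner_mult n (mass n) q) i"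
        using \<open>i \<le> n\<close>
        by (simp add: r_def inner_mult_add inner_mult_scale inner_mult_mirror[OF M])
    qed
    also have "\<dots> = (1 + \<sigma> * \<sigma>) * dot n (inner_mult n (mass n) q) q
        + 2 * \<sigma> * dot n (inner_mult n (mass n) q) (mirror n q)"
      unfolding r_def dot_linear dot_mirror_mirror by (simp add: dot_mirror_right algebra_simps)
    finally have inner: "dot n (inner_mult n (mass n) v) v = 2 * dot n (inner_mult n (mass n) q) q
        + 2 * \<sigma> * dot n (inner_mult n (mass n) q) (mirror n q)"
      using \<sigma> by simp
    have b: "dot n (bvec (mass n)) v
          = dot n (bvec (mass n)) q + \<sigma> * dot n (bvec (mass n)) (mirror n q)"
        "dot n (bvec (mass n)) (mirror n v)
          = dot n (bvec (mass n)) (mirror n q) + \<sigma> * dot n (bvec (mass n)) q"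
      unfolding dot_mirror_right dv r_def dot_linear dot_mirror_mirror by (simp_all add: dot_mirror_twice)
    have \<sigma>2: "\<sigma> * (\<sigma> * x) = x" for x
      using \<sigma> by (simp only: mult.assoc[symmetric] mult_1_left)
    have v0n: "v 0 = 1" "v n = \<sigma>" using n by (auto simp: v_def)
    have "2 * gram_form n (mass n) \<sigma> q q
        = (\<Sum>i=0..n. \<Sum>j=0..n. mass n i j * v i * v j)"
      unfolding quadratic_form_blocks[OF n M] inner b v0n gram_form_def node_form_def
        dot_linear dot_mirror_right[symmetric]
      using \<sigma> \<sigma>2 by (simp add: algebra_simps power2_eq_square)
    then show ?thesis
      using mass_pos_def[OF n, of 0 v] v0n by simp
  qed
  have "gram_form n (mass n) \<theta> q q
      = (1 + \<theta>) / 2 * gram_form n (mass n) 1 q q + (1 - \<theta>) / 2 * gram_form n (mass n) (- 1) q q"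
    unfolding gram_form_def node_form_def by (simp add: field_simps)
  moreover have "(1 + \<theta>) / 2 * gram_form n (mass n) 1 q q \<ge> 0"
    "(1 - \<theta>) / 2 * gram_form n (mass n) (- 1) q q \<ge> 0"
    using ends[of 1] ends[of "- 1"] \<theta> by (auto intro!: mult_nonneg_nonneg)
  \<comment> \<open>One of the two weights may vanish at an end point of the interval, but never
    both.\<close>
  moreover have "(1 + \<theta>) / 2 * gram_form n (mass n) 1 q q > 0
      \<or> (1 - \<theta>) / 2 * gram_form n (mass n) (- 1) q q > 0"
    using ends[of 1] ends[of "- 1"] \<theta> by (cases "\<theta> > 0") (auto intro!: mult_pos_pos)
  ultimately show ?thesis by linarith
qed

text \<open>A left inverse of a square matrix is a right inverse, so orthonormality of \<open>n - 1\<close> vectors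
  gives completeness.\<close>

lemma orthonormal_complete:
  assumes orth: "\<And>l m. l \<in> {1..n-1} \<Longrightarrow> m \<in> {1..n-1} \<Longrightarrow>
    dot n (e l) (inner_mult n M (e m)) = (if l = m then 1 else 0)"
  shows "dot n x q = (\<Sum>l=1..n-1. dot n x (e l) * dot n (inner_mult n M (e l)) q)"
proof -
  define N where "N = n - 1"
  have shift: "(\<Sum>i=1..n-1. f i) = (\<Sum>i=0..<N. f (Suc i))" for f :: "nat \<Rightarrow> real"
    by (simp add: N_def sum.atLeast1_atMost_eq lessThan_atLeast0)
  \<comment> \<open>The rows of \<open>A\<close> are the vectors \<open>e l\<close> and the columns
    of \<open>W\<close> their images under \<open>M\<close>: orthonormality reads
    \<open>A * W = 1\<close>, and completeness is the reversed product. The shift by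
    \<open>Suc\<close> is due to matrix indices starting at 0.\<close>
  define A where "A = Matrix.mat N N (\<lambda>(l, i). e (Suc l) (Suc i))"
  define W where "W = Matrix.mat N N (\<lambda>(i, l). inner_mult n M (e (Suc l)) (Suc i))"
  have carrier: "A \<in> carrier_mat N N" "W \<in> carrier_mat N N"
    by (simp_all add: A_def W_def)
  have "A * W = 1\<^sub>m N"
  proof (rule eq_matI)
    fix l m assume "l < dim_row (1\<^sub>m N)" "m < dim_col (1\<^sub>m N)"
    then have lm: "l < N" "m < N" by simp_all
    then have "(A * W) $$ (l, m) = dot n (e (Suc l)) (inner_mult n M (e (Suc m)))"
      unfolding dot_def shift by (simp add: A_def W_def scalar_prod_def)
    also have "\<dots> = 1\<^sub>m N $$ (l, m)"
      using lm by (subst orth) (auto simp: N_def)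
    finally show "(A * W) $$ (l, m) = 1\<^sub>m N $$ (l, m)" .
  qed (use carrier in auto)
  then have "W * A = 1\<^sub>m N"
    by (rule mat_mult_left_right_inverse[OF carrier])
  then have WA: "(\<Sum>l=0..<N. inner_mult n M (e (Suc l)) (Suc i) * e (Suc l) (Suc j)) = (if i = j then 1 else 0)"
    if "i < N" "j < N" for i j
  proof -
    have "(W * A) $$ (i, j) = (\<Sum>l=0..<N. inner_mult n M (e (Suc l)) (Suc i) * e (Suc l) (Suc j))"
      using that by (simp add: A_def W_def scalar_prod_def)
    then show ?thesis using \<open>W * A = 1\<^sub>m N\<close> that by simp
  qed
  have "(\<Sum>l=1..n-1. dot n x (e l) * dot n (inner_mult n M (e l)) q)
      = (\<Sum>l=0..<N. \<Sum>j=0..<N. \<Sum>i=0..<N. x (Suc j) * q (Suc i)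
          * (inner_mult n M (e (Suc l)) (Suc i) * e (Suc l) (Suc j)))"
    unfolding dot_def shift sum_product by (simp add: mult_ac)
  also have "\<dots> = (\<Sum>j=0..<N. \<Sum>l=0..<N. \<Sum>i=0..<N. x (Suc j) * q (Suc i)
          * (inner_mult n M (e (Suc l)) (Suc i) * e (Suc l) (Suc j)))"
    by (rule sum.swap)
  also have "\<dots> = (\<Sum>j=0..<N. \<Sum>i=0..<N. x (Suc j) * q (Suc i)
          * (\<Sum>l=0..<N. inner_mult n M (e (Suc l)) (Suc i) * e (Suc l) (Suc j)))"
    unfolding sum_distrib_left by (intro sum.cong refl sum.swap)
  also have "\<dots> = (\<Sum>j=0..<N. \<Sum>i=0..<N. x (Suc j) * q (Suc i) * (if i = j then 1 else 0))"
    by (intro sum.cong refl) (simp only: WA atLeastLessThan_iff)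
  also have "\<dots> = dot n x q"
    unfolding dot_def shift by (intro sum.cong refl) (simp add: if_distrib cong: if_cong)
  finally show ?thesis by simp
qed

lemma eigenvectors_orthogonal:
  assumes A: "bisym n A" and C: "bisym n C"
    and u: "gen_eigenvector {1..n-1} A C \<mu> u" and v: "gen_eigenvector {1..n-1} A C \<nu> v"
    and "\<mu> \<noteq> \<nu>"
  shows "dot n u (inner_mult n C v) = 0"
proof -
  have "dot n (inner_mult n A u) v = dot n (\<lambda>i. \<mu> * inner_mult n C u i) v"
    using u by (intro dot_cong) (auto simp: gen_eigenvector_def inner_mult_def)
  moreover have "dot n u (inner_mult n A v) = dot n u (\<lambda>i. \<nu> * inner_mult n C v i)"
    using v by (intro dot_cong) (auto simp: gen_eigenvector_def inner_mult_def)
  ultimately have "\<mu> * dot n u (inner_mult n C v) = \<nu> * dot n u (inner_mult n C v)"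
    unfolding dot_linear dot_inner_mult[OF A] dot_inner_mult[OF C] by (rule trans[OF sym])
  then show ?thesis using \<open>\<mu> \<noteq> \<nu>\<close> by auto
qed

lemma bisym_diff: "bisym n A \<Longrightarrow> bisym n C \<Longrightarrow> bisym n (\<lambda>i j. A i j - \<mu> * C i j)"
  by (simp add: bisym_def)

text \<open>Expanding \<open>q\<close> in the inner eigenvectors turns the spectral equation into the nodal
  component of the global eigenvalue equation.\<close>

lemma node_form_eq_0:
  assumes A: "bisym n (stiff n)" and C: "bisym n (mass n)"
    and e: "\<And>l. l \<in> {1..n-1} \<Longrightarrow> gen_eigenvector {1..n-1} (stiff n) (mass n) (lam0 l) (e l)"
    and orth: "\<And>l m. l \<in> {1..n-1} \<Longrightarrow> m \<in> {1..n-1} \<Longrightarrow>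
      dot n (e l) (inner_mult n (mass n) (e m)) = (if l = m then 1 else 0)"
    and \<mu>: "\<mu> \<in> spectral_solutions n lam0 e \<theta>"
    and q: "\<And>i. i \<in> {1..n-1} \<Longrightarrow> inner_mult n (\<lambda>i m. stiff n i m - \<mu> * mass n i m) q i
              = - (bvec (stiff n) i - \<mu> * bvec (mass n) i)"
  shows "node_form n (\<lambda>i m. stiff n i m - \<mu> * mass n i m) \<theta> q = 0"
proof -
  define G where "G = (\<lambda>i m. stiff n i m - \<mu> * mass n i m)"
  define g where "g = bvec G"
  have g_eq: "g = (\<lambda>i. bvec (stiff n) i - \<mu> * bvec (mass n) i)"
    by (simp add: g_def G_def bvec_def fun_eq_iff)
  have gm_eq: "mirror n g = (\<lambda>i. mirror n (bvec (stiff n)) i - \<mu> * mirror n (bvec (mass n)) i)"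
    by (simp add: g_eq mirror_def fun_eq_iff)
  have coeff: "dot n (inner_mult n (mass n) (e l)) q = dot n g (e l) / (\<mu> - lam0 l)"
    if l: "l \<in> {1..n-1}" for l
  proof -
    \<comment> \<open>The explicit exclusion of the poles from \<open>spectral_solutions\<close>
      permits division by \<open>\<mu> - lam0 l\<close>.\<close>
    have "lam0 l \<in> spec_inner n"
      using e[OF l] by (auto simp: spec_inner_def gen_spectrum_def)
    then have ne: "\<mu> \<noteq> lam0 l"
      using \<mu> by (auto simp: spectral_solutions_def)
    have "dot n (inner_mult n G (e l)) q
        = dot n (\<lambda>i. (lam0 l - \<mu>) * inner_mult n (mass n) (e l) i) q"
      using e[OF l] by (intro dot_cong)
        (simp_all add: gen_eigenvector_def G_def inner_mult_def left_diff_distrib sum_subtractf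
          sum_distrib_left mult.assoc)
    moreover have "dot n (e l) (inner_mult n G q) = dot n (e l) (\<lambda>i. - g i)"
      using q by (intro dot_cong) (simp_all add: G_def g_eq)
    ultimately have "(lam0 l - \<mu>) * dot n (inner_mult n (mass n) (e l)) q = - dot n g (e l)"
      using dot_inner_mult[of n G "e l" q] bisym_diff[OF A C, of \<mu>]
      by (simp add: G_def dot_linear dot_commute[of n g])
    then show ?thesis using ne by (simp add: field_simps)
  qed
  have expand: "dot n x q = (\<Sum>l=1..n-1. dot n x (e l) * dot n g (e l) / (\<mu> - lam0 l))" for x
  proof -
    have "dot n x q = (\<Sum>l=1..n-1. dot n x (e l) * dot n (inner_mult n (mass n) (e l)) q)"
      by (rule orthonormal_complete[OF orth])
    also have "\<dots> = (\<Sum>l=1..n-1. dot n x (e l) * dot n g (e l) / (\<mu> - lam0 l))"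
      by (intro sum.cong refl) (simp only: coeff times_divide_eq_right)
    finally show ?thesis .
  qed
  have ge: "dot n (bvec (stiff n)) x - \<mu> * dot n (bvec (mass n)) x = dot n g x"
    "dot n (mirror n (bvec (stiff n))) x - \<mu> * dot n (mirror n (bvec (mass n))) x = dot n (mirror n g) x" for x
    by (simp only: g_eq dot_linear) (simp only: gm_eq dot_linear)
  \<comment> \<open>Taking \<open>x\<close> to be \<open>g\<close> and its mirror in
    \<open>expand\<close> produces exactly the two sums of the spectral equation.\<close>
  have "G 0 0 + dot n g q = - \<theta> * (G 0 n + dot n (mirror n g) q)"
    using \<mu> unfolding spectral_solutions_def mem_Collect_eq power2_eq_square ge expand G_def
    by blast
  then show ?thesis
    unfolding node_form_def G_def[symmetric] g_def[symmetric] by (simp add: algebra_simps)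
qed

section \<open>Transforms\<close>

text \<open>The end nodes lie half a step on either side of the element centre. By the addition
  formulas the sum of the two sines, which goes with the even part, is a sine at the centre, and
  their difference, which goes with the odd part, a cosine.\<close>

lemma s_pos_elt_centre:
  assumes "j \<ge> 1"
  shows "q i * sn K k (j - 1) + mirror n q i * sn K k j
    = 2 * (even_part n q i * cos (pi * real k / (2 * real K)) * sin (pi * real k * (real j - 1/2) / real K))
      - 2 * (odd_part n q i * sin (pi * real k / (2 * real K)) * cos (pi * real k * (real j - 1/2) / real K))"
proof -
  define x where "x = pi * real k * (real j - 1/2) / real K"
  define h where "h = pi * real k / (2 * real K)"
  have "pi * real k * real (j - 1) / real K = x - h" "pi * real k * real j / real K = x + h"
    using assms unfolding x_def h_def
    by (cases "K = 0"; simp add: of_nat_diff field_simps)+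
  then have sn_eq: "sn K k (j - 1) = sin x * cos h - cos x * sin h" "sn K k j = sin x * cos h + cos x * sin h"
    unfolding sn_def by (simp_all only: sin_add sin_diff)
  show ?thesis
    unfolding sn_eq x_def[symmetric] h_def[symmetric] even_part_def odd_part_def
    by (simp add: field_simps)
qed

lemma neg_mirror_pow_sum:
  assumes "i \<le> n"
  shows "(neg_mirror n ^^ m) (\<lambda>i. \<Sum>l\<in>L. c l * f l i) i = (\<Sum>l\<in>L. c l * (neg_mirror n ^^ m) (f l) i)"
  using assms by (simp add: neg_mirror_pow mirror_def sum_negf)

lemma expansion_nodal:
  assumes "j \<in> {1..K-1}"
    and "\<And>l. l \<in> {1..n-1} \<Longrightarrow> s 0 l = s_zero n (e l)"
    and "\<And>k l. k \<in> {1..K-1} \<Longrightarrow> l \<in> {1..n} \<Longrightarrow> s k l = s_pos n K k (p k l)"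
  shows "nodal (expansion n K wc s) j = (\<Sum>k=1..K-1. (\<Sum>l=1..n. wc k l) * sn K k j)"
proof -
  have "(\<Sum>l=1..n-1. wc 0 l * nodal (s 0 l) j) = 0"
    by (intro sum.neutral ballI) (simp add: assms(2) s_zero_def)
  moreover have "(\<Sum>k=1..K-1. \<Sum>l=1..n. wc k l * nodal (s k l) j)
      = (\<Sum>k=1..K-1. \<Sum>l=1..n. wc k l * sn K k j)"
    using assms(1) by (intro sum.cong refl) (simp add: assms(3) s_pos_def)
  ultimately show ?thesis
    by (simp add: expansion_def sum_distrib_right)
qed

lemma expansion_elt:
  assumes j: "j \<in> {1..K}" and i: "i \<in> {1..n-1}"
    and s0: "\<And>l. l \<in> {1..n-1} \<Longrightarrow> s 0 l = s_zero n (e l)"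
    and sk: "\<And>k l. k \<in> {1..K-1} \<Longrightarrow> l \<in> {1..n} \<Longrightarrow> s k l = s_pos n K k (p k l)"
    and d: "\<And>k. k \<in> {1..K-1} \<Longrightarrow> d k = (\<lambda>i. \<Sum>l=1..n. wc k l * p k l i)"
  shows "elt (expansion n K wc s) j i
    = (neg_mirror n ^^ (j - 1)) (\<lambda>i. \<Sum>l=1..n-1. wc 0 l * e l i) i
      + 2 * (\<Sum>k=1..K-1. even_part n (d k) i * cos (pi * real k / (2 * real K))
                            * sin (pi * real k * (real j - 1/2) / real K))
      - 2 * (\<Sum>k=1..K-1. odd_part n (d k) i * sin (pi * real k / (2 * real K))
                            * cos (pi * real k * (real j - 1/2) / real K))"
proof -
  have j1: "j \<ge> 1" and i': "i \<le> n" using i j by auto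
  have "(\<Sum>l=1..n-1. wc 0 l * elt (s 0 l) j i)
      = (neg_mirror n ^^ (j - 1)) (\<lambda>i. \<Sum>l=1..n-1. wc 0 l * e l i) i"
    unfolding neg_mirror_pow_sum[OF i'] by (intro sum.cong refl) (simp add: s0 s_zero_def)
  moreover have "(\<Sum>k=1..K-1. \<Sum>l=1..n. wc k l * elt (s k l) j i)
      = (\<Sum>k=1..K-1. d k i * sn K k (j - 1) + mirror n (d k) i * sn K k j)"
  proof (intro sum.cong refl)
    fix k assume k: "k \<in> {1..K-1}"
    have "(\<Sum>l=1..n. wc k l * elt (s k l) j i)
        = (\<Sum>l=1..n. wc k l * p k l i * sn K k (j - 1) + wc k l * mirror n (p k l) i * sn K k j)"
      by (intro sum.cong refl) (simp add: sk[OF k] s_pos_def algebra_simps)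
    then show "(\<Sum>l=1..n. wc k l * elt (s k l) j i) = d k i * sn K k (j - 1) + mirror n (d k) i * sn K k j"
      by (simp add: d[OF k] mirror_def sum.distrib sum_distrib_right)
  qed
  ultimately show ?thesis
    unfolding s_pos_elt_centre[OF j1]
    by (simp add: expansion_def sum_subtractf sum_distrib_left)
qed

text \<open>DST-III reads one entry more than there are vectors \<open>d k\<close>; the extension by
  zero at \<open>k = K\<close> supplies it.\<close>

lemma DST_III_inv_input_even:
  assumes "K \<ge> 1"
  shows "DST_III K (inv_input_even n K d i) j
    = 2 * (\<Sum>k=1..K-1. even_part n (d k) i * cos (pi * real k / (2 * real K))
                          * sin (pi * real k * (real j - 1/2) / real K))"
proof -
  define f where "f k = inv_input_even n K d i k * sin (pi * real k * (real j - 1/2) / real K)" for k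
  have "DST_III K (inv_input_even n K d i) j = (\<Sum>k=1..K. f k)"
    by (simp add: DST_III_def f_def)
  also have "\<dots> = (\<Sum>k=1..K-1. f k)"
    by (rule sum_boundary_right) (simp add: f_def inv_input_even_def)
  also have "\<dots> = 2 * (\<Sum>k=1..K-1. even_part n (d k) i * cos (pi * real k / (2 * real K))
                          * sin (pi * real k * (real j - 1/2) / real K))"
    unfolding sum_distrib_left by (intro sum.cong refl) (auto simp: f_def inv_input_even_def)
  finally show ?thesis .
qed

lemma DCT_III_inv_input_odd:
  "DCT_III K (inv_input_odd n K d i) j
    = - 2 * (\<Sum>k=1..K-1. odd_part n (d k) i * sin (pi * real k / (2 * real K))
                          * cos (pi * real k * (real j - 1/2) / real K))"
proof -
  define f where "f k = inv_input_odd n K d i k * cos (pi * real k * (real j - 1/2) / real K)" for k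
  have "DCT_III K (inv_input_odd n K d i) j = (\<Sum>k=0..K-1. f k)"
    by (simp add: DCT_III_def f_def)
  also have "\<dots> = (\<Sum>k=1..K-1. f k)"
    by (rule sum.mono_neutral_right) (auto simp: f_def inv_input_odd_def not_le less_Suc_eq)
  also have "\<dots> = - 2 * (\<Sum>k=1..K-1. odd_part n (d k) i * sin (pi * real k / (2 * real K))
                          * cos (pi * real k * (real j - 1/2) / real K))"
    unfolding sum_distrib_left by (intro sum.cong refl) (auto simp: f_def inv_input_odd_def)
  finally show ?thesis .
qed

lemma SK_inner_s_pos_parts:
  "SK_inner n K y (s_pos n K k q)
    = (\<Sum>j=1..K-1. nodal y j * sin (pi * real k * real j / real K))
      + dot n (even_part n q)
          (\<lambda>i. \<Sum>j=1..K-1. even_part n (\<lambda>i. elt y j i + elt y (j + 1) i) i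
                             * sin (pi * real k * real j / real K))
      + dot n (odd_part n q)
          (\<lambda>i. \<Sum>j=1..K-1. odd_part n (\<lambda>i. elt y (j + 1) i - elt y j i) i
                             * sin (pi * real k * real j / real K))"
  unfolding SK_inner_s_pos dot_even_odd_parts dot_sum_right dot_scale_right' sn_def distrib_right
    sum.distrib
  by (simp only: mult.commute add.assoc)

text \<open>Exchanging the sum over nodes with the sum over retained components leaves one scalar
  transform per component. The input arrays do not involve \<open>q\<close>, so the same
  \<open>n\<close> transforms serve every \<open>l\<close>; only the weights change.\<close>

lemma SK_inner_s_pos_DST_I:
  assumes "n \<ge> 1"
  shows "SK_inner n K y (s_pos n K k q)
    = (\<Sum>m=0..n-1. dir_weight n q m * DST_I K (dir_input n y m) k)"
proof -
  define S where "S j = sin (pi * real k * real j / real K)" for j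
  \<comment> \<open>The sine kernel is symmetric in its two indices, so the same transform also sums
    over nodes.\<close>
  have dst: "DST_I K x k = (\<Sum>j=1..K-1. x j * S j)" for x
    by (simp add: DST_I_def S_def mult_ac)
  define f where "f m = dir_weight n q m * DST_I K (dir_input n y m) k" for m
  define r where "r j = even_part n (\<lambda>i. elt y j i + elt y (j + 1) i)" for j
  define t where "t j = odd_part n (\<lambda>i. elt y (j + 1) i - elt y j i)" for j
  have "dot n (even_part n q) (\<lambda>i. \<Sum>j=1..K-1. r j i * S j)
      = (\<Sum>j=1..K-1. S j * (\<Sum>m=1..n div 2. (if 2 * m = n then 1 else 2) * even_part n q m * r j m))"
    unfolding dot_sum_right dot_scale_right' r_def dot_even_even ..
  also have "\<dots> = (\<Sum>m=1..n div 2. \<Sum>j=1..K-1. S j * ((if 2 * m = n then 1 else 2) * even_part n q m * r j m))"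
    unfolding sum_distrib_left by (rule sum.swap)
  also have "\<dots> = (\<Sum>m=1..n div 2. f m)"
    unfolding f_def dst sum_distrib_left
    by (intro sum.cong refl) (simp add: dir_weight_def dir_input_def r_def mult_ac)
  finally have ev: "dot n (even_part n q) (\<lambda>i. \<Sum>j=1..K-1. r j i * S j) = (\<Sum>m=1..n div 2. f m)" .
  have "dot n (odd_part n q) (\<lambda>i. \<Sum>j=1..K-1. t j i * S j)
      = (\<Sum>j=1..K-1. S j * (\<Sum>m=1..(n-1) div 2. 2 * odd_part n q m * t j m))"
    unfolding dot_sum_right dot_scale_right' t_def dot_odd_odd ..
  also have "\<dots> = (\<Sum>m=1..(n-1) div 2. \<Sum>j=1..K-1. S j * (2 * odd_part n q m * t j m))"
    unfolding sum_distrib_left by (rule sum.swap)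
  also have "\<dots> = (\<Sum>m=1..(n-1) div 2. f (m + n div 2))"
    unfolding f_def dst sum_distrib_left
    by (intro sum.cong refl) (simp add: dir_weight_def dir_input_def t_def mult_ac)
  \<comment> \<open>The odd components are numbered after the \<open>n div 2\<close> even ones, and
    the last number is \<open>n div 2 + (n - 1) div 2 = n - 1\<close>.\<close>
  also have "\<dots> = (\<Sum>m=n div 2 + 1..n-1. f m)"
    using assms
    by (intro sum.reindex_bij_witness[where i="\<lambda>m. m - n div 2" and j="\<lambda>m. m + n div 2"]) auto
  finally have od: "dot n (odd_part n q) (\<lambda>i. \<Sum>j=1..K-1. t j i * S j) = (\<Sum>m=n div 2 + 1..n-1. f m)" .
  have "{0..n-1} = insert 0 ({1..n div 2} \<union> {n div 2 + 1..n-1})"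
    using assms by auto
  then have "(\<Sum>m=0..n-1. f m) = f 0 + (\<Sum>m=1..n div 2. f m) + (\<Sum>m=n div 2 + 1..n-1. f m)"
    by (simp add: sum.union_disjoint)
  moreover have "f 0 = (\<Sum>j=1..K-1. nodal y j * S j)"
    by (simp add: f_def dst dir_weight_def dir_input_def)
  ultimately show ?thesis
    using SK_inner_s_pos_parts[of n K y k q]
    unfolding f_def[symmetric] S_def[symmetric] r_def[symmetric] t_def[symmetric] ev od by simp
qed

text \<open>The nodal and the element part each contribute one border term; this is the origin of
  the factor 2 in the norm coefficients.\<close>

lemma gram_form_diagonal:
  "gram_form n M \<theta> q q = (M 0 0 + dot n (\<lambda>i. inner_mult n M q i + 2 * bvec M i) q)
    + (M 0 n + dot n (\<lambda>i. inner_mult n M q i + 2 * bvec M i) (mirror n q)) * \<theta>"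
  unfolding gram_form_def node_form_def dot_linear dot_mirror_right[symmetric]
  by (simp add: algebra_simps)

theorem theorem2p4:
  fixes n K :: nat
    and lam0 :: "nat \<Rightarrow> real" and e :: "nat \<Rightarrow> nat \<Rightarrow> real"
    and lam :: "nat \<Rightarrow> nat \<Rightarrow> real" and p :: "nat \<Rightarrow> nat \<Rightarrow> nat \<Rightarrow> real"
    and s :: "nat \<Rightarrow> nat \<Rightarrow> gfun"
    and w y :: gfun and wc :: "nat \<Rightarrow> nat \<Rightarrow> real"
    and d :: "nat \<Rightarrow> nat \<Rightarrow> real" and b0 bn :: "nat \<Rightarrow> nat \<Rightarrow> real"
  assumes n: "n \<ge> 2" and K: "K \<ge> 1"
    and simple_full: "\<forall>\<mu>\<in>spec_full n. simple_eigenvalue {0..n} (stiff n) (mass n) \<mu>"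
    and simple_inner: "\<forall>\<mu>\<in>spec_inner n. simple_eigenvalue {1..n-1} (stiff n) (mass n) \<mu>"
    \<comment> \<open>eigenpairs of the inner local problem\<close>
    and lam0: "bij_betw lam0 {1..n-1} (spec_inner n)"
    and e: "\<forall>l\<in>{1..n-1}. gen_eigenvector {1..n-1} (stiff n) (mass n) (lam0 l) (e l)"
    and e_scaled: "\<forall>l\<in>{1..n-1}. dot n (inner_mult n (mass n) (e l)) (e l) = 1"
    \<comment> \<open>the n distinct solutions of the spectral equation, and the vectors p\<close>
    and lam: "\<forall>k\<in>{1..K-1}. bij_betw (lam k) {1..n} (spectral_solutions n lam0 e (theta K k))"
    and p: "\<forall>k\<in>{1..K-1}. \<forall>l\<in>{1..n}. \<forall>i\<in>{1..n-1}.
              inner_mult n (\<lambda>i m. stiff n i m - lam k l * mass n i m) (p k l) i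
              = - (bvec (stiff n) i - lam k l * bvec (mass n) i)"
    and s0: "\<forall>l\<in>{1..n-1}. s 0 l = s_zero n (e l)"
    and sk: "\<forall>k\<in>{1..K-1}. \<forall>l\<in>{1..n}. s k l = s_pos n K k (p k l)"
    and w: "w \<in> SK K"
    and w_expansion: "SK_eq n K w (expansion n K wc s)"
    and d: "\<forall>k\<in>{1..K-1}. d k = (\<lambda>i. \<Sum>l=1..n. wc k l * p k l i)"
    and y: "y = glob_mass n K w"
    and b0: "\<forall>k\<in>{1..K-1}. \<forall>l\<in>{1..n}. b0 k l = mass n 0 0
               + dot n (\<lambda>i. inner_mult n (mass n) (p k l) i + 2 * bvec (mass n) i) (p k l)"
    and bn: "\<forall>k\<in>{1..K-1}. \<forall>l\<in>{1..n}. bn k l = mass n 0 n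
               + dot n (\<lambda>i. inner_mult n (mass n) (p k l) i + 2 * bvec (mass n) i) (mirror n (p k l))"
  shows "
    \<comment> \<open>1. inverse transform\<close>
    (\<forall>j\<in>{1..K-1}. nodal w j = (\<Sum>k=1..K-1. (\<Sum>l=1..n. wc k l) * sin (pi * real k * real j / real K))) \<and>
    (\<forall>j\<in>{1..K}. \<forall>i\<in>{1..n-1}. elt w j i =
        (neg_mirror n ^^ (j - 1)) (\<lambda>i. \<Sum>l=1..n-1. wc 0 l * e l i) i
        + 2 * (\<Sum>k=1..K-1. even_part n (d k) i * cos (pi * real k / (2 * real K))
                              * sin (pi * real k * (real j - 1/2) / real K))
        - 2 * (\<Sum>k=1..K-1. odd_part n (d k) i * sin (pi * real k / (2 * real K))
                              * cos (pi * real k * (real j - 1/2) / real K))) \<and>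
    (\<forall>q :: nat \<Rightarrow> real. \<forall>j\<ge>1. \<forall>i\<in>{1..n-1}.
        (neg_mirror n ^^ (j - 1)) q i = (if odd j then q i else - mirror n q i)) \<and>
    \<comment> \<open>computation by one DST-I\<close>
    (\<forall>j\<in>{1..K-1}. nodal w j = DST_I K (\<lambda>k. \<Sum>l=1..n. wc k l) j) \<and>
    \<comment> \<open>computation by n div 2 transforms DST-III and (n - 1) div 2 transforms DCT-III\<close>
    (n div 2 + (n - 1) div 2 = n - 1) \<and>
    (\<forall>j\<in>{1..K}. \<forall>i\<in>{1..n div 2}. elt w j i =
        (neg_mirror n ^^ (j - 1)) (\<lambda>i. \<Sum>l=1..n-1. wc 0 l * e l i) i
        + DST_III K (inv_input_even n K d i) j
        + (if i \<le> (n - 1) div 2 then DCT_III K (inv_input_odd n K d i) j else 0)) \<and>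
    (\<forall>j\<in>{1..K}. \<forall>i\<in>{1..(n - 1) div 2}. elt w j (n - i) =
        (neg_mirror n ^^ (j - 1)) (\<lambda>i. \<Sum>l=1..n-1. wc 0 l * e l i) (n - i)
        + DST_III K (inv_input_even n K d i) j
        - DCT_III K (inv_input_odd n K d i) j) \<and>
    \<comment> \<open>2. direct transform\<close>
    (\<forall>l\<in>{1..n-1}. mass_norm_sq n K (s 0 l) \<noteq> 0 \<and>
        wc 0 l = SK_inner n K (glob_mass n K w) (s 0 l) / mass_norm_sq n K (s 0 l)) \<and>
    (\<forall>k\<in>{1..K-1}. \<forall>l\<in>{1..n}. mass_norm_sq n K (s k l) \<noteq> 0 \<and>
        wc k l = SK_inner n K (glob_mass n K w) (s k l) / mass_norm_sq n K (s k l)) \<and>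
    (\<forall>l\<in>{1..n-1}. SK_inner n K (glob_mass n K w) (s 0 l) =
        dot n (inner_mult n (mass n) (\<lambda>i. \<Sum>j=1..K. (neg_mirror n ^^ (j - 1)) (elt w j) i)) (e l)) \<and>
    (\<forall>l\<in>{1..n-1}. mass_norm_sq n K (s 0 l) = real K) \<and>
    (\<forall>k\<in>{1..K-1}. \<forall>l\<in>{1..n}. SK_inner n K y (s k l) =
        (\<Sum>j=1..K-1. nodal y j * sin (pi * real k * real j / real K))
        + dot n (even_part n (p k l))
            (\<lambda>i. \<Sum>j=1..K-1. even_part n (\<lambda>i. elt y j i + elt y (j + 1) i) i
                               * sin (pi * real k * real j / real K))
        + dot n (odd_part n (p k l))
            (\<lambda>i. \<Sum>j=1..K-1. odd_part n (\<lambda>i. elt y (j + 1) i - elt y j i) i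
                               * sin (pi * real k * real j / real K))) \<and>
    (\<forall>k\<in>{1..K-1}. \<forall>l\<in>{1..n}.
        mass_norm_sq n K (s k l) = real K * (b0 k l + bn k l * theta K k)) \<and>
    \<comment> \<open>computation by n direct transforms DST-I, numbered by m\<close>
    (\<forall>k\<in>{1..K-1}. \<forall>l\<in>{1..n}. SK_inner n K y (s k l) =
        (\<Sum>m=0..n-1. dir_weight n (p k l) m * DST_I K (dir_input n y m) k))"
proof -
  have n1: "n \<ge> 1" using n by simp
  note A = bisym_stiff[OF n1] and C = bisym_mass[OF n1]
  have s0': "s 0 l = s_zero n (e l)" if "l \<in> {1..n-1}" for l
    using s0 that by blast
  have sk': "s k l = s_pos n K k (p k l)" if "k \<in> {1..K-1}" "l \<in> {1..n}" for k l
    using sk that by blast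
  have d': "d k = (\<lambda>i. \<Sum>l=1..n. wc k l * p k l i)" if "k \<in> {1..K-1}" for k
    using d that by blast
  have orth: "dot n (e l) (inner_mult n (mass n) (e m)) = (if l = m then 1 else 0)"
    if l: "l \<in> {1..n-1}" and m: "m \<in> {1..n-1}" for l m
  proof (cases "l = m")
    case True
    then show ?thesis using e_scaled m by (simp add: dot_commute)
  next
    case False
    then have "lam0 l \<noteq> lam0 m"
      using inj_on_contraD[OF bij_betw_imp_inj_on[OF lam0] _ l m] by simp
    then show ?thesis
      using eigenvectors_orthogonal[OF A C bspec[OF e l] bspec[OF e m]] False by simp
  qed
  have gram: "gram_form n (mass n) (theta K k) (p k l) (p k m) = 0"
    if k: "k \<in> {1..K-1}" and l: "l \<in> {1..n}" and m: "m \<in> {1..n}" and "l \<noteq> m" for k l m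
  proof -
    \<comment> \<open>The second argument stays arbitrary, so the relation can be used from either
      side of the symmetric form.\<close>
    have eig: "gram_form n (stiff n) (theta K k) (p k l) r
        = lam k l * gram_form n (mass n) (theta K k) (p k l) r" if l: "l \<in> {1..n}" for l r
    proof -
      have sol: "lam k l \<in> spectral_solutions n lam0 e (theta K k)"
        using bij_betw_apply[OF bspec[OF lam k] l] .
      have q: "inner_mult n (\<lambda>i m. stiff n i m - lam k l * mass n i m) (p k l) i
              = - (bvec (stiff n) i - lam k l * bvec (mass n) i)" if "i \<in> {1..n-1}" for i
        using p k l that by blast
      have "node_form n (\<lambda>i m. stiff n i m - lam k l * mass n i m) (theta K k) (p k l) = 0"
        using e by (intro node_form_eq_0[OF A C _ orth sol q]) auto
      then have "gram_form n (\<lambda>i m. stiff n i m - lam k l * mass n i m) (theta K k) (p k l) r = 0"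
        by (rule gram_form_eq_0) (simp add: q, simp add: bvec_def)
      then show ?thesis by (simp add: gram_form_diff)
    qed
    have "lam k l * gram_form n (mass n) (theta K k) (p k l) (p k m)
        = lam k m * gram_form n (mass n) (theta K k) (p k l) (p k m)"
      using eig[OF l, of "p k m"] eig[OF m, of "p k l"]
      by (simp only: gram_form_commute[OF A, of _ "p k m" "p k l"]
          gram_form_commute[OF C, of _ "p k m" "p k l"])
    moreover have "lam k l \<noteq> lam k m"
      using inj_on_contraD[OF bij_betw_imp_inj_on[OF bspec[OF lam k]] \<open>l \<noteq> m\<close> l m] .
    ultimately show ?thesis by simp
  qed
  have w_coeff: "SK_inner n K (glob_mass n K w) x
      = (\<Sum>l=1..n-1. wc 0 l * SK_inner n K (glob_mass n K (s 0 l)) x)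
        + (\<Sum>k=1..K-1. \<Sum>l=1..n. wc k l * SK_inner n K (glob_mass n K (s k l)) x)" for x
    unfolding glob_mass_def SK_inner_glob_op_cong[OF w_expansion] SK_inner_glob_op_expansion ..
  have norm0: "mass_norm_sq n K (s 0 l) = real K" if l: "l \<in> {1..n-1}" for l
    using s_zero_gram[OF C K, of "e l" "e l"] e_scaled l
    by (simp add: s0' mass_norm_sq_def glob_mass_def)
  have normk: "mass_norm_sq n K (s k l) = real K * gram_form n (mass n) (theta K k) (p k l) (p k l)"
    if k: "k \<in> {1..K-1}" and l: "l \<in> {1..n}" for k l
    using s_pos_gram[OF C k k, of "p k l" "p k l"]
    by (simp add: sk'[OF k l] mass_norm_sq_def glob_mass_def)
  have coeff0: "SK_inner n K (glob_mass n K w) (s 0 l) = wc 0 l * real K" if l: "l \<in> {1..n-1}" for l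
  proof -
    have "(\<Sum>m=1..n-1. wc 0 m * SK_inner n K (glob_mass n K (s 0 m)) (s 0 l))
        = (\<Sum>m=1..n-1. if m = l then wc 0 m * real K else 0)"
    proof (intro sum.cong refl)
      fix m assume m: "m \<in> {1..n-1}"
      show "wc 0 m * SK_inner n K (glob_mass n K (s 0 m)) (s 0 l) = (if m = l then wc 0 m * real K else 0)"
        using orth[OF m l]
        by (simp add: s0'[OF m] s0'[OF l] glob_mass_def s_zero_gram[OF C K] dot_inner_mult[OF C])
    qed
    moreover have "(\<Sum>k=1..K-1. \<Sum>m=1..n. wc k m * SK_inner n K (glob_mass n K (s k m)) (s 0 l)) = 0"
      by (intro sum.neutral ballI)
        (simp add: sk' s0'[OF l] glob_mass_def s_pos_s_zero_orthogonal[OF C K])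
    ultimately show ?thesis
      unfolding w_coeff using l by simp
  qed
  have coeffk: "SK_inner n K (glob_mass n K w) (s k l) = wc k l * mass_norm_sq n K (s k l)"
    if k: "k \<in> {1..K-1}" and l: "l \<in> {1..n}" for k l
  proof -
    have "(\<Sum>m=1..n-1. wc 0 m * SK_inner n K (glob_mass n K (s 0 m)) (s k l)) = 0"
      by (intro sum.neutral ballI)
        (simp add: sk'[OF k l] s0' glob_mass_def s_zero_s_pos_orthogonal[OF C])
    \<comment> \<open>The test on \<open>m\<close> is the outer one so that the inner sum collapses
      first and leaves a sum over \<open>r\<close> of the same shape.\<close>
    moreover have "(\<Sum>r=1..K-1. \<Sum>m=1..n. wc r m * SK_inner n K (glob_mass n K (s r m)) (s k l))
        = (\<Sum>r=1..K-1. \<Sum>m=1..n. if m = l then if r = k then wc r m * mass_norm_sq n K (s k l) else 0 else 0)"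
    proof (intro sum.cong refl)
      fix r m assume r: "r \<in> {1..K-1}" and m: "m \<in> {1..n}"
      show "wc r m * SK_inner n K (glob_mass n K (s r m)) (s k l)
          = (if m = l then if r = k then wc r m * mass_norm_sq n K (s k l) else 0 else 0)"
        using gram[OF k m l]
        by (simp add: sk'[OF r m] sk'[OF k l] normk[OF k l, unfolded sk'[OF k l]]
            glob_mass_def s_pos_gram[OF C r k])
    qed
    ultimately show ?thesis
      unfolding w_coeff using k l by simp
  qed
  have normk_pos: "mass_norm_sq n K (s k l) \<noteq> 0" if k: "k \<in> {1..K-1}" and l: "l \<in> {1..n}" for k l
    using normk[OF k l] gram_form_mass_pos[OF n1 theta_bounds, of K k "p k l"] K by simp
  have part_nodal: "nodal w j = (\<Sum>k=1..K-1. (\<Sum>l=1..n. wc k l) * sin (pi * real k * real j / real K))"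
    if j: "j \<in> {1..K-1}" for j
  proof -
    have "nodal w j = nodal (expansion n K wc s) j"
      using w_expansion j unfolding SK_eq_def by auto
    then show ?thesis
      using expansion_nodal[OF j s0' sk'] by (simp add: sn_def)
  qed
  have part_elt: "elt w j i =
        (neg_mirror n ^^ (j - 1)) (\<lambda>i. \<Sum>l=1..n-1. wc 0 l * e l i) i
        + 2 * (\<Sum>k=1..K-1. even_part n (d k) i * cos (pi * real k / (2 * real K))
                              * sin (pi * real k * (real j - 1/2) / real K))
        - 2 * (\<Sum>k=1..K-1. odd_part n (d k) i * sin (pi * real k / (2 * real K))
                              * cos (pi * real k * (real j - 1/2) / real K))"
    if j: "j \<in> {1..K}" and i: "i \<in> {1..n-1}" for j i
  proof -
    have "elt w j i = elt (expansion n K wc s) j i"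
      using w_expansion j i unfolding SK_eq_def by auto
    then show ?thesis
      using expansion_elt[OF j i s0' sk' d'] by simp
  qed
  show ?thesis
  proof (intro conjI ballI allI impI)
    fix j assume "j \<in> {1..K-1}"
    then show "nodal w j = (\<Sum>k=1..K-1. (\<Sum>l=1..n. wc k l) * sin (pi * real k * real j / real K))"
      "nodal w j = DST_I K (\<lambda>k. \<Sum>l=1..n. wc k l) j"
      by (simp_all only: part_nodal DST_I_def)
  next
    fix q :: "nat \<Rightarrow> real" and j i :: nat
    assume "j \<ge> 1" "i \<in> {1..n-1}"
    then have "i \<le> n" "even (j - 1) \<longleftrightarrow> odd j" by auto
    then show "(neg_mirror n ^^ (j - 1)) q i = (if odd j then q i else - mirror n q i)"
      by (simp add: neg_mirror_pow)
  next
    fix j i assume j: "j \<in> {1..K}" and i: "i \<in> {1..n div 2}"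
    have i': "i \<in> {1..n-1}" using i n by auto
    \<comment> \<open>The only index up to \<open>n div 2\<close> that exceeds
      \<open>(n - 1) div 2\<close> is the middle one of an even \<open>n\<close>.\<close>
    have "odd_part n (d k) i = 0" if "\<not> i \<le> (n - 1) div 2" for k
      using that i by (intro odd_part_middle) auto
    then show "elt w j i = (neg_mirror n ^^ (j - 1)) (\<lambda>i. \<Sum>l=1..n-1. wc 0 l * e l i) i
        + DST_III K (inv_input_even n K d i) j
        + (if i \<le> (n - 1) div 2 then DCT_III K (inv_input_odd n K d i) j else 0)"
      unfolding part_elt[OF j i'] DST_III_inv_input_even[OF K] DCT_III_inv_input_odd by simp
  next
    fix j i assume j: "j \<in> {1..K}" and i: "i \<in> {1..(n-1) div 2}"
    have i': "n - i \<in> {1..n-1}" "i \<le> n" using i n by auto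
    \<comment> \<open>The mirrored component reuses the transforms of component \<open>i\<close>,
      with the sign of the odd one reversed.\<close>
    show "elt w j (n - i) = (neg_mirror n ^^ (j - 1)) (\<lambda>i. \<Sum>l=1..n-1. wc 0 l * e l i) (n - i)
        + DST_III K (inv_input_even n K d i) j - DCT_III K (inv_input_odd n K d i) j"
      unfolding part_elt[OF j i'(1)] DST_III_inv_input_even[OF K] DCT_III_inv_input_odd
        even_part_mirror[OF i'(2)] odd_part_mirror[OF i'(2)]
      by (simp add: sum_negf)
  next
    fix l assume l: "l \<in> {1..n-1}"
    show "mass_norm_sq n K (s 0 l) = real K" by (rule norm0[OF l])
    show "mass_norm_sq n K (s 0 l) \<noteq> 0" using norm0[OF l] K by simp
    show "wc 0 l = SK_inner n K (glob_mass n K w) (s 0 l) / mass_norm_sq n K (s 0 l)"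
      using coeff0[OF l] norm0[OF l] K by simp
    show "SK_inner n K (glob_mass n K w) (s 0 l)
        = dot n (inner_mult n (mass n) (\<lambda>i. \<Sum>j=1..K. (neg_mirror n ^^ (j - 1)) (elt w j) i)) (e l)"
      unfolding s0'[OF l] glob_mass_def using w
      by (intro SK_inner_s_zero[OF C K]) (simp_all add: SK_def)
  next
    fix k l assume k: "k \<in> {1..K-1}" and l: "l \<in> {1..n}"
    show "mass_norm_sq n K (s k l) \<noteq> 0" by (rule normk_pos[OF k l])
    then show "wc k l = SK_inner n K (glob_mass n K w) (s k l) / mass_norm_sq n K (s k l)"
      using coeffk[OF k l] by simp
    show "mass_norm_sq n K (s k l) = real K * (b0 k l + bn k l * theta K k)"
      using b0 bn k l unfolding normk[OF k l] gram_form_diagonal by simp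
    show "SK_inner n K y (s k l) =
        (\<Sum>j=1..K-1. nodal y j * sin (pi * real k * real j / real K))
        + dot n (even_part n (p k l))
            (\<lambda>i. \<Sum>j=1..K-1. even_part n (\<lambda>i. elt y j i + elt y (j + 1) i) i
                               * sin (pi * real k * real j / real K))
        + dot n (odd_part n (p k l))
            (\<lambda>i. \<Sum>j=1..K-1. odd_part n (\<lambda>i. elt y (j + 1) i - elt y j i) i
                               * sin (pi * real k * real j / real K))"
      unfolding sk'[OF k l] by (rule SK_inner_s_pos_parts)
    show "SK_inner n K y (s k l) = (\<Sum>m=0..n-1. dir_weight n (p k l) m * DST_I K (dir_input n y m) k)"
      unfolding sk'[OF k l] by (rule SK_inner_s_pos_DST_I[OF n1])
  next
    show "n div 2 + (n - 1) div 2 = n - 1" using n by presburger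
  qed (rule part_elt)
qed

end
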